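(* Let $G=N\rtimes H$ be a locally compact group which is the semi-direct product of a closed normal subgroup $N$ and a closed subgroup $H$. (i) $G$ is MAP if and only if $H$ is MAP and $\widehat{N}_{\mathrm{fd}}^{H-\mathrm{per}}$ separates the points of $N$. (ii) $G$ is RF if and only if $H$ is RF and $\widehat{N}_{\mathrm{finite}}^{H-\mathrm{per}}$ separates the points of $N$.
   Context: For a topological group $G$, $\widehat{G}_{\mathrm{fd}}$ is the set of equivalence classes (modulo unitary equivalence) of irreducible finite dimensional unitary representations of $G$, i.e. of irreducible continuous homomorphisms $\pi:G\to U(n)$, $n\ge1$; $\widehat{G}_{\mathrm{finite}}$ is the subset of those $\pi$ with finite image $\pi(G)$. $G$ is maximally almost periodic (MAP) if $\widehat{G}_{\mathrm{fd}}$ separates the points of $G$; $G$ is residually finite (RF) if $\widehat{G}_{\mathrm{finite}}$ separates the points of $G$. (A set of representations separates the points of $G$ if for all $g\ne g'$ in $G$ some representation $\pi$ in the set satisfies $\pi(g)\ne\pi(g')$.) For $G=N\rtimes H$, the group $H$ acts on $\widehat{N}_{\mathrm{fd}}$, preserving $\widehat{N}_{\mathrm{finite}}$, by $\sigma\mapsto\sigma^h$, where $\sigma^h(n)=\sigma(h^{-1}nh)$ for $n\in N$. $\widehat{N}_{\mathrm{fd}}^{H-\mathrm{per}}$ and $\widehat{N}_{\mathrm{finite}}^{H-\mathrm{per}}$ are the subsets of $\widehat{N}_{\mathrm{fd}}$ and $\widehat{N}_{\mathrm{finite}}$, respectively, of elements with finite $H$-orbit. *)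

theory Defs
  imports
    "HOL-Analysis.Analysis"
    "HOL-Algebra.Coset"
    "Jordan_Normal_Form.VS_Connect"
    "Jordan_Normal_Form.Schur_Decomposition"
begin

section \<open>Topological groups and topological semi-direct products\<close>

definition topological_group :: "('a, 'b) monoid_scheme \<Rightarrow> 'a topology \<Rightarrow> bool" where
  "topological_group G T \<longleftrightarrow>
     group G \<and> topspace T = carrier G \<and>
     continuous_map (prod_topology T T) T (\<lambda>(x, y). x \<otimes>\<^bsub>G\<^esub> y) \<and>
     continuous_map T T (\<lambda>x. inv\<^bsub>G\<^esub> x)"

text \<open>As usual, locally compact groups are understood to be Hausdorff.\<close>

definition locally_compact_group :: "('a, 'b) monoid_scheme \<Rightarrow> 'a topology \<Rightarrow> bool" where
  "locally_compact_group G T \<longleftrightarrow>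
     topological_group G T \<and> Hausdorff_space T \<and> locally_compact_space T"

abbreviation subgroup_of :: "('a, 'b) monoid_scheme \<Rightarrow> 'a set \<Rightarrow> ('a, 'b) monoid_scheme" where
  "subgroup_of G S \<equiv> G\<lparr>carrier := S\<rparr>"

text \<open>
  \<open>G = N \<rtimes> H\<close> as topological groups: besides the algebraic conditions, the topology of \<open>G\<close> is
  the product topology of \<open>N \<times> H\<close>. For a general locally compact group this last condition does
  not follow from \<open>N\<close> and \<open>H\<close> being closed.
\<close>

definition topological_semidirect_product ::
    "('a, 'b) monoid_scheme \<Rightarrow> 'a topology \<Rightarrow> 'a set \<Rightarrow> 'a set \<Rightarrow> bool" where
  "topological_semidirect_product G T N H \<longleftrightarrow>
     N \<lhd> G \<and> subgroup H G \<and> closedin T N \<and> closedin T H \<and>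
     N <#>\<^bsub>G\<^esub> H = carrier G \<and> N \<inter> H = {\<one>\<^bsub>G\<^esub>} \<and>
     homeomorphic_map (prod_topology (subtopology T N) (subtopology T H)) T
       (\<lambda>(x, h). x \<otimes>\<^bsub>G\<^esub> h)"

section \<open>Finite dimensional unitary representations\<close>

definition unitary_mat :: "nat \<Rightarrow> complex mat \<Rightarrow> bool" where
  "unitary_mat n U \<longleftrightarrow>
     U \<in> carrier_mat n n \<and> U * mat_adjoint U = 1\<^sub>m n \<and> mat_adjoint U * U = 1\<^sub>m n"

text \<open>
  A continuous homomorphism \<open>G \<rightarrow> U(n)\<close>. The topology of \<open>U(n)\<close> is the one induced from
  \<open>\<complex>\<^bsup>n\<times>n\<^esup>\<close>, so that continuity is continuity of all matrix entries.
\<close>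

definition unitary_rep ::
    "('a, 'b) monoid_scheme \<Rightarrow> 'a topology \<Rightarrow> nat \<Rightarrow> ('a \<Rightarrow> complex mat) \<Rightarrow> bool" where
  "unitary_rep G T n \<pi> \<longleftrightarrow>
     (\<forall>g\<in>carrier G. unitary_mat n (\<pi> g)) \<and>
     (\<forall>g\<in>carrier G. \<forall>h\<in>carrier G. \<pi> (g \<otimes>\<^bsub>G\<^esub> h) = \<pi> g * \<pi> h) \<and>
     (\<forall>i<n. \<forall>j<n. continuous_map T euclidean (\<lambda>g. \<pi> g $$ (i, j)))"

definition irreducible_rep ::
    "('a, 'b) monoid_scheme \<Rightarrow> nat \<Rightarrow> ('a \<Rightarrow> complex mat) \<Rightarrow> bool" where
  "irreducible_rep G n \<pi> \<longleftrightarrow>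
     n \<ge> 1 \<and>
     (\<forall>W. VectorSpace.subspace class_ring W (module_vec TYPE(complex) n) \<and>
          (\<forall>g\<in>carrier G. \<forall>w\<in>W. \<pi> g *\<^sub>v w \<in> W)
        \<longrightarrow> W = {0\<^sub>v n} \<or> W = carrier_vec n)"

text \<open>A representation is encoded as the pair of its dimension and the homomorphism.\<close>

type_synonym 'a rep = "nat \<times> ('a \<Rightarrow> complex mat)"

definition fd_irreps :: "('a, 'b) monoid_scheme \<Rightarrow> 'a topology \<Rightarrow> 'a rep set" where
  "fd_irreps G T = {(n, \<pi>). unitary_rep G T n \<pi> \<and> irreducible_rep G n \<pi>}"

definition unitary_equivalence ::
    "('a, 'b) monoid_scheme \<Rightarrow> 'a topology \<Rightarrow> ('a rep \<times> 'a rep) set" where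
  "unitary_equivalence G T =
     {((n, \<pi>), (m, \<rho>)). (n, \<pi>) \<in> fd_irreps G T \<and> (m, \<rho>) \<in> fd_irreps G T \<and> n = m \<and>
        (\<exists>U. unitary_mat n U \<and> (\<forall>g\<in>carrier G. \<rho> g = U * \<pi> g * mat_adjoint U))}"

lemma mat_adjoint_carrier: "A \<in> carrier_mat n n \<Longrightarrow> mat_adjoint A \<in> carrier_mat n n"
  by (auto simp: mat_adjoint_def)

lemma mat_adjoint_index:
  fixes A :: "complex mat"
  assumes "A \<in> carrier_mat n n" "i < n" "j < n"
  shows "mat_adjoint A $$ (i, j) = cnj (A $$ (j, i))"
  using assms by (auto simp: mat_adjoint_def mat_of_rows_index)

lemma mat_adjoint_adjoint:
  fixes A :: "complex mat"
  assumes "A \<in> carrier_mat n n"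
  shows "mat_adjoint (mat_adjoint A) = A"
  by (rule eq_matI)
     (use assms mat_adjoint_carrier[OF assms] mat_adjoint_carrier[OF mat_adjoint_carrier[OF assms]]
       in \<open>auto simp: mat_adjoint_index[of _ n]\<close>)

lemma mat_adjoint_mult:
  fixes A B :: "complex mat"
  assumes A: "A \<in> carrier_mat n n" and B: "B \<in> carrier_mat n n"
  shows "mat_adjoint (A * B) = mat_adjoint B * mat_adjoint A"
proof (rule eq_matI)
  have AB: "A * B \<in> carrier_mat n n" using A B by simp
  have dims: "dim_row A = n" "dim_col A = n" "dim_row B = n" "dim_col B = n"
    "dim_row (mat_adjoint A) = n" "dim_col (mat_adjoint A) = n"
    "dim_row (mat_adjoint B) = n" "dim_col (mat_adjoint B) = n"
    using A B mat_adjoint_carrier[OF A] mat_adjoint_carrier[OF B] by auto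
  show "dim_row (mat_adjoint (A * B)) = dim_row (mat_adjoint B * mat_adjoint A)"
    and "dim_col (mat_adjoint (A * B)) = dim_col (mat_adjoint B * mat_adjoint A)"
    using mat_adjoint_carrier[OF AB] dims by auto
  fix i j assume "i < dim_row (mat_adjoint B * mat_adjoint A)"
    and "j < dim_col (mat_adjoint B * mat_adjoint A)"
  then have ij: "i < n" "j < n" using dims by auto
  have "mat_adjoint (A * B) $$ (i, j) = cnj ((A * B) $$ (j, i))"
    using mat_adjoint_index[OF AB] ij by simp
  also have "\<dots> = (mat_adjoint B * mat_adjoint A) $$ (i, j)"
    using ij dims by (simp add: scalar_prod_def mat_adjoint_index[OF A] mat_adjoint_index[OF B] mult.commute)
  finally show "mat_adjoint (A * B) $$ (i, j) = (mat_adjoint B * mat_adjoint A) $$ (i, j)" .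
qed

lemma unitary_mat_one: "unitary_mat n (1\<^sub>m n)"
proof -
  have "mat_adjoint (1\<^sub>m n) = (1\<^sub>m n :: complex mat)"
    by (rule eq_matI)
       (use mat_adjoint_carrier[of "1\<^sub>m n :: complex mat" n] in \<open>auto simp: mat_adjoint_index[of _ n]\<close>)
  then show ?thesis by (simp add: unitary_mat_def)
qed

lemma unitary_mat_adjoint: "unitary_mat n U \<Longrightarrow> unitary_mat n (mat_adjoint U)"
  by (auto simp: unitary_mat_def mat_adjoint_adjoint mat_adjoint_carrier)

lemma unitary_mat_mult:
  assumes "unitary_mat n U" "unitary_mat n V"
  shows "unitary_mat n (U * V)"
proof -
  have c: "U \<in> carrier_mat n n" "V \<in> carrier_mat n n"
    "mat_adjoint U \<in> carrier_mat n n" "mat_adjoint V \<in> carrier_mat n n"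
    using assms by (auto simp: unitary_mat_def mat_adjoint_carrier)
  have "U * V * (mat_adjoint V * mat_adjoint U) = U * (V * mat_adjoint V) * mat_adjoint U"
    using c by (simp add: assoc_mult_mat[of _ n n _ n _ n])
  moreover have "mat_adjoint V * mat_adjoint U * (U * V) = mat_adjoint V * (mat_adjoint U * U) * V"
    using c by (simp add: assoc_mult_mat[of _ n n _ n _ n])
  ultimately show ?thesis
    using assms c by (simp add: unitary_mat_def mat_adjoint_mult[OF c(1,2)])
qed

lemma unitary_conjugation_comp:
  assumes "unitary_mat n U" "unitary_mat n V" "A \<in> carrier_mat n n"
  shows "V * (U * A * mat_adjoint U) * mat_adjoint V = (V * U) * A * mat_adjoint (V * U)"
proof -
  have c: "U \<in> carrier_mat n n" "V \<in> carrier_mat n n"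
    "mat_adjoint U \<in> carrier_mat n n" "mat_adjoint V \<in> carrier_mat n n"
    using assms by (auto simp: unitary_mat_def mat_adjoint_carrier)
  then show ?thesis
    using assms(3) by (simp add: mat_adjoint_mult[OF c(2,1)] assoc_mult_mat[of _ n n _ n _ n])
qed

lemma unitary_conjugation_cancel:
  assumes "unitary_mat n U" "A \<in> carrier_mat n n"
  shows "mat_adjoint U * (U * A * mat_adjoint U) * mat_adjoint (mat_adjoint U) = A"
proof -
  have "U \<in> carrier_mat n n" using assms by (simp add: unitary_mat_def)
  then have "mat_adjoint U * (U * A * mat_adjoint U) * mat_adjoint (mat_adjoint U)
      = (mat_adjoint U * U) * A * mat_adjoint (mat_adjoint U * U)"
    using unitary_conjugation_comp[OF assms(1) unitary_mat_adjoint[OF assms(1)] assms(2)] by simp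
  moreover have "mat_adjoint (1\<^sub>m n) = (1\<^sub>m n :: complex mat)"
    using unitary_mat_one[of n] mat_adjoint_carrier[of "1\<^sub>m n :: complex mat" n]
    by (simp add: unitary_mat_def)
  ultimately show ?thesis using assms by (simp add: unitary_mat_def)
qed

lemma fd_irreps_carrier: "(n, \<pi>) \<in> fd_irreps G T \<Longrightarrow> g \<in> carrier G \<Longrightarrow> \<pi> g \<in> carrier_mat n n"
  by (auto simp: fd_irreps_def unitary_rep_def unitary_mat_def)

lemma unitary_equivalenceI:
  assumes "(n, \<pi>) \<in> fd_irreps G T" "(n, \<rho>) \<in> fd_irreps G T" "unitary_mat n U"
    and "\<And>g. g \<in> carrier G \<Longrightarrow> \<rho> g = U * \<pi> g * mat_adjoint U"
  shows "((n, \<pi>), (n, \<rho>)) \<in> unitary_equivalence G T"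
  unfolding unitary_equivalence_def using assms by blast

lemma unitary_equivalenceE:
  assumes "((n, \<pi>), q) \<in> unitary_equivalence G T"
  obtains \<rho> U where "q = (n, \<rho>)" "(n, \<pi>) \<in> fd_irreps G T" "(n, \<rho>) \<in> fd_irreps G T"
    "unitary_mat n U" "\<And>g. g \<in> carrier G \<Longrightarrow> \<rho> g = U * \<pi> g * mat_adjoint U"
  using assms unfolding unitary_equivalence_def by blast

lemma equiv_unitary_equivalence: "equiv (fd_irreps G T) (unitary_equivalence G T)"
proof (rule equivI)
  show "unitary_equivalence G T \<subseteq> fd_irreps G T \<times> fd_irreps G T"
    unfolding unitary_equivalence_def by blast
  show "refl_on (fd_irreps G T) (unitary_equivalence G T)"
  proof (rule refl_onI)
    fix p assume p: "p \<in> fd_irreps G T"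
    obtain n \<pi> where np: "p = (n, \<pi>)" by (cases p)
    have "\<pi> g = 1\<^sub>m n * \<pi> g * mat_adjoint (1\<^sub>m n)" if "g \<in> carrier G" for g
    proof -
      have "\<pi> g \<in> carrier_mat n n" using fd_irreps_carrier[OF p[unfolded np] that] .
      then show ?thesis
        using unitary_mat_one[of n] mat_adjoint_carrier[of "1\<^sub>m n :: complex mat" n]
        by (simp add: unitary_mat_def)
    qed
    then show "(p, p) \<in> unitary_equivalence G T"
      using p unitary_mat_one unfolding np by (intro unitary_equivalenceI)
  qed
  show "sym (unitary_equivalence G T)"
  proof (rule symI)
    fix p q assume pq: "(p, q) \<in> unitary_equivalence G T"
    obtain n \<pi> where np: "p = (n, \<pi>)" by (cases p)
    from pq[unfolded np] obtain \<rho> U where *: "q = (n, \<rho>)" "(n, \<pi>) \<in> fd_irreps G T"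
      "(n, \<rho>) \<in> fd_irreps G T" "unitary_mat n U"
      and eq: "\<And>g. g \<in> carrier G \<Longrightarrow> \<rho> g = U * \<pi> g * mat_adjoint U"
      by (rule unitary_equivalenceE) blast
    show "(q, p) \<in> unitary_equivalence G T"
      unfolding np *(1)
      by (rule unitary_equivalenceI[OF *(3,2) unitary_mat_adjoint[OF *(4)]])
         (simp only: eq unitary_conjugation_cancel[OF *(4) fd_irreps_carrier[OF *(2)]])
  qed
  show "trans (unitary_equivalence G T)"
  proof (rule transI)
    fix p q r assume pq: "(p, q) \<in> unitary_equivalence G T" and qr: "(q, r) \<in> unitary_equivalence G T"
    obtain n \<pi> where np: "p = (n, \<pi>)" by (cases p)
    from pq[unfolded np] obtain \<rho> U where *: "q = (n, \<rho>)" "(n, \<pi>) \<in> fd_irreps G T"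
      "(n, \<rho>) \<in> fd_irreps G T" "unitary_mat n U"
      and eq: "\<And>g. g \<in> carrier G \<Longrightarrow> \<rho> g = U * \<pi> g * mat_adjoint U"
      by (rule unitary_equivalenceE) blast
    from qr[unfolded *(1)] obtain \<tau> V where **: "r = (n, \<tau>)"
      "(n, \<tau>) \<in> fd_irreps G T" "unitary_mat n V"
      and eq': "\<And>g. g \<in> carrier G \<Longrightarrow> \<tau> g = V * \<rho> g * mat_adjoint V"
      by (rule unitary_equivalenceE) blast
    show "(p, r) \<in> unitary_equivalence G T"
      unfolding np **(1)
      by (rule unitary_equivalenceI[OF *(2) **(2) unitary_mat_mult[OF **(3) *(4)]])
         (simp only: eq eq' unitary_conjugation_comp[OF *(4) **(3) fd_irreps_carrier[OF *(2)]])
  qed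
qed

definition fd_dual :: "('a, 'b) monoid_scheme \<Rightarrow> 'a topology \<Rightarrow> 'a rep set set" where
  "fd_dual G T = fd_irreps G T // unitary_equivalence G T"

definition finite_dual :: "('a, 'b) monoid_scheme \<Rightarrow> 'a topology \<Rightarrow> 'a rep set set" where
  "finite_dual G T = {C \<in> fd_dual G T. \<forall>(n, \<pi>)\<in>C. finite (\<pi> ` carrier G)}"

text \<open>
  Whether \<open>\<pi> g \<noteq> \<pi> g'\<close> depends only on the class of \<open>\<pi>\<close>, so the choice of the representative in
  the following definition is immaterial.
\<close>

definition separates_points :: "('a, 'b) monoid_scheme \<Rightarrow> 'a rep set set \<Rightarrow> bool" where
  "separates_points G S \<longleftrightarrow>
     (\<forall>g\<in>carrier G. \<forall>g'\<in>carrier G. g \<noteq> g' \<longrightarrow> (\<exists>C\<in>S. \<exists>(n, \<pi>)\<in>C. \<pi> g \<noteq> \<pi> g'))"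

definition maximally_almost_periodic :: "('a, 'b) monoid_scheme \<Rightarrow> 'a topology \<Rightarrow> bool" where
  "maximally_almost_periodic G T \<longleftrightarrow> separates_points G (fd_dual G T)"

definition residually_finite :: "('a, 'b) monoid_scheme \<Rightarrow> 'a topology \<Rightarrow> bool" where
  "residually_finite G T \<longleftrightarrow> separates_points G (finite_dual G T)"

section \<open>The action on the dual of a normal subgroup\<close>

definition conj_rep :: "('a, 'b) monoid_scheme \<Rightarrow> 'a \<Rightarrow> 'a rep \<Rightarrow> 'a rep" where
  "conj_rep G h = (\<lambda>(n, \<sigma>). (n, \<lambda>x. \<sigma> (inv\<^bsub>G\<^esub> h \<otimes>\<^bsub>G\<^esub> x \<otimes>\<^bsub>G\<^esub> h)))"

text \<open>
  The class of \<open>\<sigma>\<^sup>h\<close>, for \<open>\<sigma>\<close> ranging over the class \<open>C\<close>.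
\<close>

definition dual_action ::
    "('a, 'b) monoid_scheme \<Rightarrow> 'a topology \<Rightarrow> 'a set \<Rightarrow> 'a \<Rightarrow> 'a rep set \<Rightarrow> 'a rep set" where
  "dual_action G T N h C =
     unitary_equivalence (subgroup_of G N) (subtopology T N) `` (conj_rep G h ` C)"

lemma conj_rep_fd_irreps:
  assumes TG: "topological_group G T" and N: "N \<lhd> G" and h: "h \<in> carrier G"
    and p: "p \<in> fd_irreps (subgroup_of G N) (subtopology T N)"
  shows "conj_rep G h p \<in> fd_irreps (subgroup_of G N) (subtopology T N)"
proof -
  interpret normal N G by (rule N)
  have top: "topspace T = carrier G"
    and cm: "continuous_map (prod_topology T T) T (\<lambda>(x, y). x \<otimes>\<^bsub>G\<^esub> y)"
    using TG by (auto simp: topological_group_def)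
  obtain n \<sigma> where np: "p = (n, \<sigma>)" by (cases p)
  define c where "c x = inv\<^bsub>G\<^esub> h \<otimes>\<^bsub>G\<^esub> x \<otimes>\<^bsub>G\<^esub> h" for x
  have cN: "c x \<in> N" if "x \<in> N" for x
    unfolding c_def using inv_op_closed1[OF h that] .
  have c_mult: "c (x \<otimes>\<^bsub>G\<^esub> y) = c x \<otimes>\<^bsub>G\<^esub> c y" if "x \<in> N" "y \<in> N" for x y
  proof -
    have *: "x \<in> carrier G" "y \<in> carrier G" using that subset by auto
    have "c x \<otimes>\<^bsub>G\<^esub> c y = inv\<^bsub>G\<^esub> h \<otimes>\<^bsub>G\<^esub> x \<otimes>\<^bsub>G\<^esub> (h \<otimes>\<^bsub>G\<^esub> inv\<^bsub>G\<^esub> h) \<otimes>\<^bsub>G\<^esub> y \<otimes>\<^bsub>G\<^esub> h"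
      unfolding c_def using * h by (simp only: m_assoc m_closed inv_closed)
    also have "\<dots> = c (x \<otimes>\<^bsub>G\<^esub> y)"
      unfolding c_def using * h by (simp add: m_assoc)
    finally show ?thesis by simp
  qed
  have c_surj: "\<exists>y\<in>N. c y = x" if "x \<in> N" for x
  proof
    have "x \<in> carrier G" using that subset by auto
    then show "c (h \<otimes>\<^bsub>G\<^esub> x \<otimes>\<^bsub>G\<^esub> inv\<^bsub>G\<^esub> h) = x"
      unfolding c_def using h by (simp add: m_assoc inv_solve_left')
    show "h \<otimes>\<^bsub>G\<^esub> x \<otimes>\<^bsub>G\<^esub> inv\<^bsub>G\<^esub> h \<in> N" using inv_op_closed2[OF h that] .
  qed
  have mulc: "continuous_map X T (\<lambda>x. f x \<otimes>\<^bsub>G\<^esub> g x)"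
    if "continuous_map X T f" "continuous_map X T g" for X :: "'a topology" and f g
    using continuous_map_compose[OF continuous_map_pairedI[OF that] cm] by (simp add: o_def)
  have "continuous_map T T c"
    unfolding c_def using h top by (intro mulc) auto
  then have cc: "continuous_map (subtopology T N) (subtopology T N) c"
    using cN by (auto simp: continuous_map_in_subtopology continuous_map_from_subtopology)
  have rep: "unitary_rep (subgroup_of G N) (subtopology T N) n \<sigma>"
    and irr: "irreducible_rep (subgroup_of G N) n \<sigma>"
    using p np by (auto simp: fd_irreps_def)
  have "unitary_rep (subgroup_of G N) (subtopology T N) n (\<lambda>x. \<sigma> (c x))"
  proof -
    have "continuous_map (subtopology T N) euclidean (\<lambda>g. \<sigma> (c g) $$ (i, j))" if "i < n" "j < n" for i j
    proof -
      have "continuous_map (subtopology T N) euclidean (\<lambda>g. \<sigma> g $$ (i, j))"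
        using rep that by (simp add: unitary_rep_def)
      from continuous_map_compose[OF cc this] show ?thesis by (simp only: o_def)
    qed
    moreover have "\<sigma> (c (x \<otimes>\<^bsub>G\<^esub> y)) = \<sigma> (c x) * \<sigma> (c y)" if "x \<in> N" "y \<in> N" for x y
    proof -
      have "\<sigma> (c x \<otimes>\<^bsub>G\<^esub> c y) = \<sigma> (c x) * \<sigma> (c y)"
        using rep cN[OF that(1)] cN[OF that(2)] by (simp add: unitary_rep_def)
      then show ?thesis by (simp only: c_mult[OF that])
    qed
    moreover have "unitary_mat n (\<sigma> (c x))" if "x \<in> N" for x
      using rep cN[OF that] by (simp add: unitary_rep_def)
    ultimately show ?thesis by (simp add: unitary_rep_def)
  qed
  moreover have "irreducible_rep (subgroup_of G N) n (\<lambda>x. \<sigma> (c x))"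
  proof -
    have "(\<forall>g\<in>N. \<forall>w\<in>W. \<sigma> (c g) *\<^sub>v w \<in> W) \<longleftrightarrow> (\<forall>g\<in>N. \<forall>w\<in>W. \<sigma> g *\<^sub>v w \<in> W)" for W
      using cN c_surj by metis
    then show ?thesis using irr by (simp add: irreducible_rep_def)
  qed
  ultimately show ?thesis by (simp add: np conj_rep_def fd_irreps_def c_def)
qed

lemma dual_action_class:
  assumes TG: "topological_group G T" and N: "N \<lhd> G" and h: "h \<in> carrier G"
    and p: "p \<in> fd_irreps (subgroup_of G N) (subtopology T N)"
  defines "E \<equiv> unitary_equivalence (subgroup_of G N) (subtopology T N)"
  shows "dual_action G T N h (E `` {p}) = E `` {conj_rep G h p}"
proof -
  interpret normal N G by (rule N)
  have eqE: "equiv (fd_irreps (subgroup_of G N) (subtopology T N)) E"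
    unfolding E_def by (rule equiv_unitary_equivalence)
  have cong: "(conj_rep G h p, conj_rep G h q) \<in> E" if pq: "(p, q) \<in> E" for q
  proof -
    obtain n \<pi> where np: "p = (n, \<pi>)" by (cases p)
    from pq[unfolded E_def np] obtain \<rho> U where *: "q = (n, \<rho>)"
      "(n, \<pi>) \<in> fd_irreps (subgroup_of G N) (subtopology T N)"
      "(n, \<rho>) \<in> fd_irreps (subgroup_of G N) (subtopology T N)" "unitary_mat n U"
      and eq: "\<And>g. g \<in> carrier (subgroup_of G N) \<Longrightarrow> \<rho> g = U * \<pi> g * mat_adjoint U"
      by (rule unitary_equivalenceE) blast
    show ?thesis
      unfolding np *(1) E_def conj_rep_def prod.case
    proof (rule unitary_equivalenceI[OF _ _ *(4)])
      fix g assume "g \<in> carrier (subgroup_of G N)"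
      then have "inv\<^bsub>G\<^esub> h \<otimes>\<^bsub>G\<^esub> g \<otimes>\<^bsub>G\<^esub> h \<in> carrier (subgroup_of G N)"
        using inv_op_closed1[OF h] by simp
      then show "\<rho> (inv\<^bsub>G\<^esub> h \<otimes>\<^bsub>G\<^esub> g \<otimes>\<^bsub>G\<^esub> h)
          = U * \<pi> (inv\<^bsub>G\<^esub> h \<otimes>\<^bsub>G\<^esub> g \<otimes>\<^bsub>G\<^esub> h) * mat_adjoint U" by (rule eq)
    qed (use conj_rep_fd_irreps[OF TG N h *(2)] conj_rep_fd_irreps[OF TG N h *(3)]
         in \<open>simp_all add: conj_rep_def\<close>)
  qed
  have "E `` {conj_rep G h q} = E `` {conj_rep G h p}" if "(p, q) \<in> E" for q
    using equiv_class_eq[OF eqE cong[OF that]] by simp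
  moreover have "(p, p) \<in> E" using eqE p by (auto simp: equiv_def refl_on_def)
  ultimately show ?thesis unfolding dual_action_def E_def[symmetric] by blast
qed

definition dual_orbit ::
    "('a, 'b) monoid_scheme \<Rightarrow> 'a topology \<Rightarrow> 'a set \<Rightarrow> 'a set \<Rightarrow> 'a rep set \<Rightarrow> 'a rep set set" where
  "dual_orbit G T N H C = (\<lambda>h. dual_action G T N h C) ` H"

definition fd_dual_per ::
    "('a, 'b) monoid_scheme \<Rightarrow> 'a topology \<Rightarrow> 'a set \<Rightarrow> 'a set \<Rightarrow> 'a rep set set" where
  "fd_dual_per G T N H =
     {C \<in> fd_dual (subgroup_of G N) (subtopology T N). finite (dual_orbit G T N H C)}"

definition finite_dual_per ::
    "('a, 'b) monoid_scheme \<Rightarrow> 'a topology \<Rightarrow> 'a set \<Rightarrow> 'a set \<Rightarrow> 'a rep set set" where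
  "finite_dual_per G T N H =
     {C \<in> finite_dual (subgroup_of G N) (subtopology T N). finite (dual_orbit G T N H C)}"

end

theory Submission
  imports Defs "Jordan_Normal_Form.Spectral_Radius"
begin

text \<open>
Both parts are proved at once, for a flag \<open>fin\<close> that says whether only representations with finite
image count. Points are separated by irreducible representations as soon as they are separated by
arbitrary finite dimensional unitary ones: a reducible unitary representation splits along an
invariant subspace and its orthogonal complement, and one of the two blocks still separates
(\<open>exists_separating_irreducible_subrep\<close>). So reducible representations may be used freely.

\<^emph>\<open>From \<open>G\<close> to \<open>H\<close> and \<open>N\<close>.\<close> Representations of \<open>G\<close> are restricted. If \<open>\<sigma>\<close> is a constituent of \<open>\<pi>\<close>
restricted to \<open>N\<close>, embedded by an isometry \<open>P\<close>, then \<open>\<sigma>\<^sup>h\<close> is embedded in the same representation of \<open>N\<close>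
by \<open>\<pi>(h) P\<close>. By Schur's lemma inequivalent constituents sit orthogonally, so there are at most
\<open>dim \<pi>\<close> of them; hence the \<open>H\<close>-orbit of \<open>\<sigma>\<close> is finite (\<open>finite_orbit_of_constituent\<close>).

\<^emph>\<open>From \<open>H\<close> and \<open>N\<close> to \<open>G\<close>.\<close> Two elements of \<open>G\<close> with different images in \<open>G/N = H\<close> are separated by a
representation pulled back from \<open>H\<close>. Otherwise they have the form \<open>x h\<close> and \<open>x' h\<close> with \<open>x \<noteq> x'\<close> in
\<open>N\<close>, and some \<open>\<sigma>\<close> with finite orbit separates \<open>x\<close> from \<open>x'\<close>. In general \<open>\<sigma>\<close> extends
only projectively to \<open>N \<rtimes> H\<^sub>\<sigma>\<close>, with \<open>H\<^sub>\<sigma>\<close> its stabiliser, so there is nothing to induce from. Instead, let \<open>\<rho>\<close> be the direct sum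
of the orbit of \<open>\<sigma>\<close>, and let \<open>G\<close> act on \<open>N = G/H\<close> by \<open>g \<cdot> m = g m p(g)\<inverse>\<close>, where \<open>p\<close> is the
projection onto \<open>H\<close>. The Hilbert-Schmidt inner product of \<open>\<rho>(m)\<close> and \<open>\<rho>(m')\<close> is the character of \<open>\<rho>\<close>
at \<open>m\<inverse> m'\<close>; as \<open>H\<close> merely permutes the classes in the orbit, this number is unchanged when \<open>G\<close> moves
\<open>m\<close> and \<open>m'\<close>. Therefore \<open>\<rho>(m) \<mapsto> \<rho>(g \<cdot> m)\<close> extends to a unitary representation of \<open>G\<close> on the span of
\<open>\<rho>(N)\<close> (\<open>unitary_rep_on_span\<close>). It maps \<open>\<rho>(1)\<close> to \<open>\<rho>(x)\<close> under \<open>x h\<close>, so it separates \<open>x h\<close> from \<open>x' h\<close>, and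
if \<open>\<rho>(N)\<close> is finite then \<open>G\<close> permutes a finite spanning set, so the image is finite.
\<close>

notation mat_adjoint ("_\<^sup>H" [1000] 999)

section \<open>Isometries\<close>

lemma adj_carrier [simp]: "A \<in> carrier_mat n m \<Longrightarrow> A\<^sup>H \<in> carrier_mat m n"
  by (auto simp: mat_adjoint_def)

lemma adj_dim [simp]: "dim_row (A\<^sup>H) = dim_col A" "dim_col (A\<^sup>H) = dim_row A"
  by (auto simp: mat_adjoint_def)

lemma adj_index [simp]:
  fixes A :: "complex mat"
  assumes "i < dim_col A" "j < dim_row A"
  shows "A\<^sup>H $$ (i, j) = cnj (A $$ (j, i))"
  using assms by (auto simp: mat_adjoint_def mat_of_rows_index)

lemma adj_adj [simp]: "(A\<^sup>H)\<^sup>H = (A :: complex mat)"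
  by (rule eq_matI) auto

lemma adj_one [simp]: "(1\<^sub>m n)\<^sup>H = (1\<^sub>m n :: complex mat)"
  by (rule eq_matI) auto

lemma adj_mult_index:
  fixes A B :: "complex mat"
  assumes "A \<in> carrier_mat n k" "B \<in> carrier_mat n l" "a < k" "b < l"
  shows "(A\<^sup>H * B) $$ (a, b) = (\<Sum>i<n. cnj (A $$ (i, a)) * B $$ (i, b))"
  using assms by (auto simp: scalar_prod_def lessThan_atLeast0)

lemma adj_mult:
  fixes A B :: "complex mat"
  assumes "A \<in> carrier_mat n k" "B \<in> carrier_mat k l"
  shows "(A * B)\<^sup>H = B\<^sup>H * A\<^sup>H"
  using assms by (intro eq_matI) (auto simp: scalar_prod_def mult.commute)

definition isometry_mat :: "nat \<Rightarrow> nat \<Rightarrow> complex mat \<Rightarrow> bool" where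
  "isometry_mat n k P \<longleftrightarrow> P \<in> carrier_mat n k \<and> P\<^sup>H * P = 1\<^sub>m k"

lemma isometry_mat_carrier: "isometry_mat n k P \<Longrightarrow> P \<in> carrier_mat n k"
  and isometry_mat_adj_mult: "isometry_mat n k P \<Longrightarrow> P\<^sup>H * P = 1\<^sub>m k"
  by (auto simp: isometry_mat_def)

text \<open>
Padding \<open>P\<close> with zero rows to a square matrix would keep \<open>P\<^sup>H P = 1\<close>; a left inverse of a square matrix is
a right inverse, which a zero row excludes.
\<close>

lemma isometry_mat_dim_le:
  assumes P: "isometry_mat n k P"
  shows "k \<le> n"
proof (rule ccontr)
  assume "\<not> k \<le> n"
  then have nk: "n < k" by simp
  note Pc = isometry_mat_carrier[OF P]
  define P' where "P' = mat k k (\<lambda>(i, j). if i < n then P $$ (i, j) else 0)"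
  have P'c: "P' \<in> carrier_mat k k" by (simp add: P'_def)
  have "P'\<^sup>H * P' = P\<^sup>H * P"
  proof (rule eq_matI)
    fix a b assume "a < dim_row (P\<^sup>H * P)" "b < dim_col (P\<^sup>H * P)"
    then have ab: "a < k" "b < k" using Pc by auto
    have "(\<Sum>i<k. cnj (P' $$ (i, a)) * P' $$ (i, b)) = (\<Sum>i<n. cnj (P' $$ (i, a)) * P' $$ (i, b))"
      by (rule sum.mono_neutral_right) (use nk ab in \<open>auto simp: P'_def\<close>)
    also have "\<dots> = (\<Sum>i<n. cnj (P $$ (i, a)) * P $$ (i, b))"
      by (rule sum.cong) (use nk ab in \<open>auto simp: P'_def\<close>)
    finally show "(P'\<^sup>H * P') $$ (a, b) = (P\<^sup>H * P) $$ (a, b)"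
      by (simp only: adj_mult_index[OF Pc Pc ab] adj_mult_index[OF P'c P'c ab])
  qed (use Pc P'c in auto)
  then have "P'\<^sup>H * P' = 1\<^sub>m k" using P by (simp add: isometry_mat_def)
  then have "P' * P'\<^sup>H = 1\<^sub>m k"
    using mat_mult_left_right_inverse[OF adj_carrier[OF P'c] P'c] by simp
  then have "(P' * P'\<^sup>H) $$ (n, n) = 1" using nk by simp
  moreover have "(P' * P'\<^sup>H) $$ (n, n) = 0"
    using nk by (auto simp: P'_def scalar_prod_def)
  ultimately show False by simp
qed

lemma isometry_mat_square:
  assumes "isometry_mat n n P"
  shows "unitary_mat n P"
  using assms mat_mult_left_right_inverse[of "P\<^sup>H" n P]
  by (auto simp: isometry_mat_def unitary_mat_def)

lemma isometry_mat_mult: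
  assumes "isometry_mat n k P" "isometry_mat k l Q"
  shows "isometry_mat n l (P * Q)"
proof -
  have c: "P \<in> carrier_mat n k" "Q \<in> carrier_mat k l" "P\<^sup>H \<in> carrier_mat k n" "Q\<^sup>H \<in> carrier_mat l k"
    using assms by (auto simp: isometry_mat_def)
  have "(P * Q)\<^sup>H * (P * Q) = Q\<^sup>H * ((P\<^sup>H * P) * Q)"
    unfolding adj_mult[OF c(1,2)] using c by (simp add: assoc_mult_mat[of _ l k _ n _ l] assoc_mult_mat[of _ k n _ k _ l])
  also have "\<dots> = 1\<^sub>m l" using assms c by (simp add: isometry_mat_def)
  finally show ?thesis using c by (simp add: isometry_mat_def)
qed

lemma subspace_module_vec_iff:
  "VectorSpace.subspace class_ring W (module_vec TYPE(complex) n) \<longleftrightarrow>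
     W \<subseteq> carrier_vec n \<and> 0\<^sub>v n \<in> W \<and> (\<forall>u\<in>W. \<forall>v\<in>W. u + v \<in> W) \<and> (\<forall>c. \<forall>v\<in>W. c \<cdot>\<^sub>v v \<in> W)"
  using vec_vs[of n, where 'a = complex] vec_module[of n, where 'a = complex]
  by (auto simp: VectorSpace.subspace_def submodule_def module_vec_simps class_ring_simps)

text \<open>
One step of Gram-Schmidt: a vector orthogonal to the columns is normalised and added as a new column.
\<close>

lemma isometry_mat_append_column:
  assumes P: "isometry_mat n k P" and v: "v \<in> carrier_vec n"
    and orth: "P\<^sup>H *\<^sub>v v = 0\<^sub>v k" and "v \<noteq> 0\<^sub>v n"
  obtains P' where "isometry_mat n (Suc k) P'"
    "\<And>u. u \<in> carrier_vec (Suc k) \<Longrightarrow> \<exists>u'\<in>carrier_vec k. \<exists>c. P' *\<^sub>v u = P *\<^sub>v u' + c \<cdot>\<^sub>v v"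
proof -
  note Pc = isometry_mat_carrier[OF P]
  define s where "s = (\<Sum>i<n. (cmod (vec_index v i))\<^sup>2)"
  have "\<exists>i<n. vec_index v i \<noteq> 0"
    using v \<open>v \<noteq> 0\<^sub>v n\<close> by (metis carrier_vecD eq_vecI index_zero_vec(1) index_zero_vec(2))
  then have s: "s > 0"
    unfolding s_def by (auto intro: sum_pos2)
  define r where "r = complex_of_real (1 / sqrt s)"
  define P' where "P' = mat n (Suc k) (\<lambda>(i, j). if j < k then P $$ (i, j) else r * vec_index v i)"
  have P'c: "P' \<in> carrier_mat n (Suc k)" by (simp add: P'_def)
  have norm: "(\<Sum>i<n. cnj (r * vec_index v i) * (r * vec_index v i)) = 1"
  proof -
    have "(\<Sum>i<n. cnj (r * vec_index v i) * (r * vec_index v i)) = of_real (\<Sum>i<n. (cmod (r * vec_index v i))\<^sup>2)"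
      unfolding of_real_sum by (intro sum.cong refl) (metis complex_norm_square mult.commute)
    also have "(\<Sum>i<n. (cmod (r * vec_index v i))\<^sup>2) = (1 / s) * s"
      using s unfolding s_def sum_distrib_left r_def
      by (intro sum.cong refl) (simp add: norm_mult power_mult_distrib norm_divide power_divide s_def[symmetric])
    finally show ?thesis using s by simp
  qed
  have orth': "(\<Sum>i<n. cnj (P $$ (i, a)) * (r * vec_index v i)) = 0" if "a < k" for a
  proof -
    have "vec_index (P\<^sup>H *\<^sub>v v) a = 0" using orth that by simp
    then have "(\<Sum>i<n. cnj (P $$ (i, a)) * vec_index v i) = 0"
      using that Pc v by (simp add: mult_mat_vec_def scalar_prod_def lessThan_atLeast0)
    then have "r * (\<Sum>i<n. cnj (P $$ (i, a)) * vec_index v i) = 0" by simp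
    then show ?thesis by (simp only: sum_distrib_left mult.left_commute)
  qed
  have orth'': "(\<Sum>i<n. cnj (r * vec_index v i) * P $$ (i, a)) = 0" if "a < k" for a
    using arg_cong[OF orth'[OF that], of cnj] by (simp add: mult.commute)
  have PP: "(\<Sum>i<n. cnj (P $$ (i, a)) * P $$ (i, b)) = (if a = b then 1 else 0)" if "a < k" "b < k" for a b
    using adj_mult_index[OF Pc Pc that] that P by (simp add: isometry_mat_def)
  have "P'\<^sup>H * P' = 1\<^sub>m (Suc k)"
  proof (rule eq_matI)
    fix a b assume "a < dim_row (1\<^sub>m (Suc k) :: complex mat)" "b < dim_col (1\<^sub>m (Suc k) :: complex mat)"
    then have ab: "a < Suc k" "b < Suc k" by auto
    have "(P'\<^sup>H * P') $$ (a, b) = (\<Sum>i<n. cnj (if a < k then P $$ (i, a) else r * vec_index v i) *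
        (if b < k then P $$ (i, b) else r * vec_index v i))"
      unfolding adj_mult_index[OF P'c P'c ab] by (rule sum.cong) (use ab in \<open>auto simp: P'_def\<close>)
    also have "\<dots> = (if a = b then 1 else 0)"
      using ab by (cases "a < k"; cases "b < k") (simp_all only: if_True if_False PP orth' orth'' norm, auto)
    finally show "(P'\<^sup>H * P') $$ (a, b) = 1\<^sub>m (Suc k) $$ (a, b)" using ab by simp
  qed (use P'c in auto)
  then have iso: "isometry_mat n (Suc k) P'" using P'c by (simp add: isometry_mat_def)
  have "\<exists>u'\<in>carrier_vec k. \<exists>c. P' *\<^sub>v u = P *\<^sub>v u' + c \<cdot>\<^sub>v v" if u: "u \<in> carrier_vec (Suc k)" for u
  proof (intro bexI exI)
    show "vec k (\<lambda>j. vec_index u j) \<in> carrier_vec k" by simp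
    show "P' *\<^sub>v u = P *\<^sub>v vec k (\<lambda>j. vec_index u j) + (r * vec_index u k) \<cdot>\<^sub>v v"
      using Pc v u by (intro eq_vecI) (auto simp: P'_def scalar_prod_def)
  qed
  with iso show thesis by (rule that)
qed

text \<open>
An orthonormal basis of a subspace, as the columns of \<open>P\<close>. An isometry into \<open>W\<close> with the largest number
of columns is onto: the component of \<open>w \<in> W\<close> orthogonal to its range lies in \<open>W\<close> and, were it nonzero,
would give one more column.
\<close>

lemma isometry_onto_subspace:
  assumes "VectorSpace.subspace class_ring W (module_vec TYPE(complex) n)"
  obtains k P where "isometry_mat n k P" "\<And>u. u \<in> carrier_vec k \<Longrightarrow> P *\<^sub>v u \<in> W"
    "\<And>w. w \<in> W \<Longrightarrow> P *\<^sub>v (P\<^sup>H *\<^sub>v w) = w"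
proof -
  have W: "W \<subseteq> carrier_vec n" "0\<^sub>v n \<in> W" "\<And>u v. u \<in> W \<Longrightarrow> v \<in> W \<Longrightarrow> u + v \<in> W"
    "\<And>c v. v \<in> W \<Longrightarrow> c \<cdot>\<^sub>v v \<in> W"
    using assms unfolding subspace_module_vec_iff by auto
  define Q where "Q k \<longleftrightarrow> (\<exists>P. isometry_mat n k P \<and> (\<forall>u\<in>carrier_vec k. P *\<^sub>v u \<in> W))" for k
  have "Q 0"
    unfolding Q_def
  proof (intro exI conjI ballI)
    show "isometry_mat n 0 (0\<^sub>m n 0)" by (auto simp: isometry_mat_def)
    show "0\<^sub>m n 0 *\<^sub>v u \<in> W" if "u \<in> carrier_vec 0" for u
    proof -
      have "0\<^sub>m n 0 *\<^sub>v u = 0\<^sub>v n" using that by (intro eq_vecI) (auto simp: scalar_prod_def)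
      then show ?thesis using W(2) by simp
    qed
  qed
  moreover have "\<forall>k. Q k \<longrightarrow> k \<le> n" unfolding Q_def using isometry_mat_dim_le by blast
  ultimately obtain k where k: "Q k" "\<And>l. Q l \<Longrightarrow> l \<le> k"
    using ex_has_greatest_nat[of Q 0 "\<lambda>x. x" "Suc n"] by (auto simp: less_Suc_eq_le)
  then obtain P where P: "isometry_mat n k P" and PW: "\<And>u. u \<in> carrier_vec k \<Longrightarrow> P *\<^sub>v u \<in> W"
    unfolding Q_def by blast
  note Pc = isometry_mat_carrier[OF P]
  have "P *\<^sub>v (P\<^sup>H *\<^sub>v w) = w" if w: "w \<in> W" for w
  proof (rule ccontr)
    have wc: "w \<in> carrier_vec n" using w W(1) by blast
    have Pwc: "P\<^sup>H *\<^sub>v w \<in> carrier_vec k" using Pc wc by (metis adj_carrier mult_mat_vec_carrier)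
    assume ne: "P *\<^sub>v (P\<^sup>H *\<^sub>v w) \<noteq> w"
    define v where "v = w + (-1) \<cdot>\<^sub>v (P *\<^sub>v (P\<^sup>H *\<^sub>v w))"
    have vW: "v \<in> W" unfolding v_def by (intro W PW w Pwc)
    have PPc: "P *\<^sub>v (P\<^sup>H *\<^sub>v w) \<in> carrier_vec n" using PW[OF Pwc] W(1) by blast
    have "y = w" if y: "y \<in> carrier_vec n" and z: "w + (-1) \<cdot>\<^sub>v y = 0\<^sub>v n" for y
    proof (rule eq_vecI)
      fix i assume "i < dim_vec w"
      then have "vec_index (w + (-1) \<cdot>\<^sub>v y) i = 0" using z wc by simp
      then show "vec_index y i = vec_index w i" using \<open>i < dim_vec w\<close> wc y by simp
    qed (use wc y in simp)
    then have "v \<noteq> 0\<^sub>v n" using ne PPc unfolding v_def by blast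
    moreover have "P\<^sup>H *\<^sub>v v = 0\<^sub>v k"
    proof -
      have "P\<^sup>H *\<^sub>v v = P\<^sup>H *\<^sub>v w + (-1) \<cdot>\<^sub>v (P\<^sup>H *\<^sub>v (P *\<^sub>v (P\<^sup>H *\<^sub>v w)))"
        unfolding v_def using adj_carrier[OF Pc] wc PPc
        by (simp add: mult_add_distrib_mat_vec[of _ k n] mult_mat_vec[of _ k n])
      also have "P\<^sup>H *\<^sub>v (P *\<^sub>v (P\<^sup>H *\<^sub>v w)) = (P\<^sup>H * P) *\<^sub>v (P\<^sup>H *\<^sub>v w)"
        using adj_carrier[OF Pc] Pc Pwc by (simp add: assoc_mult_mat_vec[of _ k n])
      also have "\<dots> = P\<^sup>H *\<^sub>v w" using P Pwc by (simp add: isometry_mat_def)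
      moreover have "x + (-1) \<cdot>\<^sub>v x = 0\<^sub>v k" if "x \<in> carrier_vec k" for x :: "complex vec"
        using that by (intro eq_vecI) auto
      ultimately show ?thesis using Pwc by simp
    qed
    moreover have "v \<in> carrier_vec n" using vW W(1) by blast
    ultimately obtain P' where P': "isometry_mat n (Suc k) P'"
      "\<And>u. u \<in> carrier_vec (Suc k) \<Longrightarrow> \<exists>u'\<in>carrier_vec k. \<exists>c. P' *\<^sub>v u = P *\<^sub>v u' + c \<cdot>\<^sub>v v"
      using isometry_mat_append_column[OF P] by metis
    have "P' *\<^sub>v u \<in> W" if "u \<in> carrier_vec (Suc k)" for u
      using P'(2)[OF that] W(3) W(4)[OF vW] PW by auto
    then have "Q (Suc k)" unfolding Q_def using P'(1) by blast
    then show False using k(2) by fastforce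
  qed
  with P PW show thesis by (rule that)
qed

lemma mat_eqI_mult_vec:
  fixes A B :: "complex mat"
  assumes A: "A \<in> carrier_mat n k" and B: "B \<in> carrier_mat n k"
    and eq: "\<And>u. u \<in> carrier_vec k \<Longrightarrow> A *\<^sub>v u = B *\<^sub>v u"
  shows "A = B"
proof (rule mat_col_eqI)
  fix j assume "j < dim_col B"
  then have j: "j < k" using B by simp
  have "M *\<^sub>v unit_vec k j = col M j" if "M \<in> carrier_mat n k" for M :: "complex mat"
    using that j by (intro eq_vecI) (auto simp: scalar_prod_right_unit)
  then show "col A j = col B j" using A B eq[of "unit_vec k j"] by simp
qed (use A B in auto)

lemma add_minus_cancel_vec:
  fixes u v :: "complex vec"
  assumes "u \<in> carrier_vec n" "v \<in> carrier_vec n"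
  shows "v + (u - v) = u"
  using assms by (intro eq_vecI) auto

text \<open>
The columns of \<open>Q\<close> are an orthonormal basis of the kernel of \<open>P\<^sup>H\<close>, the orthogonal complement of the range
of \<open>P\<close>.
\<close>

lemma isometry_mat_complement:
  assumes P: "isometry_mat n k P"
  obtains l Q where "isometry_mat n l Q" "P\<^sup>H * Q = 0\<^sub>m k l" "Q\<^sup>H * P = 0\<^sub>m l k"
    "P * P\<^sup>H + Q * Q\<^sup>H = 1\<^sub>m n"
proof -
  note Pc = isometry_mat_carrier[OF P] and PHc = adj_carrier[OF isometry_mat_carrier[OF P]]
  define W where "W = {w \<in> carrier_vec n. P\<^sup>H *\<^sub>v w = 0\<^sub>v k}"
  have "P\<^sup>H *\<^sub>v 0\<^sub>v n = 0\<^sub>v k" using Pc by (intro eq_vecI) auto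
  then have "VectorSpace.subspace class_ring W (module_vec TYPE(complex) n)"
    unfolding subspace_module_vec_iff W_def using PHc
    by (auto simp: mult_add_distrib_mat_vec[of _ k n] mult_mat_vec[of _ k n])
  then obtain l Q where Q: "isometry_mat n l Q" "\<And>u. u \<in> carrier_vec l \<Longrightarrow> Q *\<^sub>v u \<in> W"
    "\<And>w. w \<in> W \<Longrightarrow> Q *\<^sub>v (Q\<^sup>H *\<^sub>v w) = w"
    by (rule isometry_onto_subspace) blast
  note Qc = isometry_mat_carrier[OF Q(1)] and QHc = adj_carrier[OF isometry_mat_carrier[OF Q(1)]]
  have PQ: "P\<^sup>H * Q = 0\<^sub>m k l"
    using Q(2) Qc PHc by (intro mat_eqI_mult_vec[of _ k l]) (auto simp: W_def assoc_mult_mat_vec[of _ k n])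
  then have "(P\<^sup>H * Q)\<^sup>H = (0\<^sub>m k l)\<^sup>H" by simp
  also have "(0\<^sub>m k l)\<^sup>H = (0\<^sub>m l k :: complex mat)" by (rule eq_matI) auto
  finally have QP: "Q\<^sup>H * P = 0\<^sub>m l k" by (simp add: adj_mult[OF PHc Qc])
  have "P * P\<^sup>H + Q * Q\<^sup>H = 1\<^sub>m n"
  proof (rule mat_eqI_mult_vec[of _ n n])
    fix u :: "complex vec" assume u: "u \<in> carrier_vec n"
    define w where "w = u - P *\<^sub>v (P\<^sup>H *\<^sub>v u)"
    have c: "P\<^sup>H *\<^sub>v u \<in> carrier_vec k" "P *\<^sub>v (P\<^sup>H *\<^sub>v u) \<in> carrier_vec n" "w \<in> carrier_vec n"
      using Pc u mult_mat_vec_carrier[OF PHc u] mult_mat_vec_carrier[OF Pc mult_mat_vec_carrier[OF PHc u]]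
      by (auto simp: w_def)
    have "P\<^sup>H *\<^sub>v (P *\<^sub>v (P\<^sup>H *\<^sub>v u)) = (P\<^sup>H * P) *\<^sub>v (P\<^sup>H *\<^sub>v u)"
      using assoc_mult_mat_vec[OF PHc Pc c(1)] by simp
    also have "\<dots> = P\<^sup>H *\<^sub>v u" using isometry_mat_adj_mult[OF P] one_mult_mat_vec[OF c(1)] by simp
    finally have "P\<^sup>H *\<^sub>v w = 0\<^sub>v k"
      using mult_minus_distrib_mat_vec[OF PHc u c(2)] minus_cancel_vec[OF c(1)] by (simp add: w_def)
    then have "w \<in> W" using c by (simp add: W_def)
    have "Q\<^sup>H *\<^sub>v (P *\<^sub>v (P\<^sup>H *\<^sub>v u)) = (Q\<^sup>H * P) *\<^sub>v (P\<^sup>H *\<^sub>v u)"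
      using c Pc QHc by (simp add: assoc_mult_mat_vec[of _ l n])
    also have "\<dots> = 0\<^sub>v l" unfolding QP using c(1) by (intro eq_vecI) auto
    finally have "Q\<^sup>H *\<^sub>v w = Q\<^sup>H *\<^sub>v u"
      using c u QHc by (simp add: w_def mult_minus_distrib_mat_vec[of _ l n]) 
    then have "Q *\<^sub>v (Q\<^sup>H *\<^sub>v u) = w" using Q(3)[OF \<open>w \<in> W\<close>] by simp
    then have "P *\<^sub>v (P\<^sup>H *\<^sub>v u) + Q *\<^sub>v (Q\<^sup>H *\<^sub>v u) = u"
      unfolding w_def using c(2) u by (metis add_minus_cancel_vec)
    then show "(P * P\<^sup>H + Q * Q\<^sup>H) *\<^sub>v u = 1\<^sub>m n *\<^sub>v u"
      using u Pc PHc Qc QHc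
      by (simp add: add_mult_distrib_mat_vec[of _ n n] assoc_mult_mat_vec[OF Pc PHc u] assoc_mult_mat_vec[OF Qc QHc u])
  qed (use Pc Qc in auto)
  with Q(1) PQ QP show thesis by (rule that)
qed

section \<open>Subrepresentations\<close>

lemma unitary_mat_carrier: "unitary_mat n U \<Longrightarrow> U \<in> carrier_mat n n"
  by (simp add: unitary_mat_def)

lemma unitary_mat_isometry: "unitary_mat n U \<Longrightarrow> isometry_mat n n U"
  by (simp add: unitary_mat_def isometry_mat_def)

lemma unitary_rep_unitary: "unitary_rep G T n \<pi> \<Longrightarrow> g \<in> carrier G \<Longrightarrow> unitary_mat n (\<pi> g)"
  by (simp add: unitary_rep_def)

lemma unitary_rep_carrier: "unitary_rep G T n \<pi> \<Longrightarrow> g \<in> carrier G \<Longrightarrow> \<pi> g \<in> carrier_mat n n"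
  by (simp add: unitary_rep_def unitary_mat_def)

lemma isometry_mat_cancel:
  assumes P: "isometry_mat n k P" and A: "A \<in> carrier_mat k m"
  shows "P\<^sup>H * (P * A) = A"
proof -
  note Pc = isometry_mat_carrier[OF P]
  have "P\<^sup>H * (P * A) = (P\<^sup>H * P) * A"
    using assoc_mult_mat[OF adj_carrier[OF Pc] Pc A] by simp
  then show ?thesis using P A by (simp add: isometry_mat_def)
qed

lemma isometry_mat_right_factor:
  assumes P: "isometry_mat n k P" and A: "A \<in> carrier_mat k m" and PA: "isometry_mat n m (P * A)"
  shows "isometry_mat k m A"
proof -
  note Pc = isometry_mat_carrier[OF P]
  have "A\<^sup>H * A = A\<^sup>H * (P\<^sup>H * (P * A))" by (simp add: isometry_mat_cancel[OF P A])
  also have "\<dots> = (P * A)\<^sup>H * (P * A)"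
    unfolding adj_mult[OF Pc A]
    using Pc A by (simp add: assoc_mult_mat[of "A\<^sup>H" m k "P\<^sup>H" n "P * A" m])
  finally show ?thesis using PA A by (simp add: isometry_mat_def)
qed

lemma continuous_map_sum_complex:
  fixes f :: "'i \<Rightarrow> 'a \<Rightarrow> complex"
  assumes "\<And>i. i \<in> I \<Longrightarrow> continuous_map X euclidean (f i)"
  shows "continuous_map X euclidean (\<lambda>x. \<Sum>i\<in>I. f i x)"
  using assms by (auto simp: continuous_map_atin intro!: tendsto_sum)

lemma continuous_map_mult_complex:
  fixes f g :: "'a \<Rightarrow> complex"
  assumes "continuous_map X euclidean f" "continuous_map X euclidean g"
  shows "continuous_map X euclidean (\<lambda>x. f x * g x)"
  using assms by (auto simp: continuous_map_atin intro!: tendsto_mult)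

text \<open>
Subrepresentations are handled through isometric intertwiners \<open>P\<close>, so that a constituent on an
invariant subspace is again given by matrices.
\<close>

definition embeds_via ::
    "('a, 'b) monoid_scheme \<Rightarrow> nat \<Rightarrow> ('a \<Rightarrow> complex mat) \<Rightarrow> nat \<Rightarrow> ('a \<Rightarrow> complex mat) \<Rightarrow> complex mat \<Rightarrow> bool" where
  "embeds_via G k \<sigma> n \<pi> P \<longleftrightarrow>
     isometry_mat n k P \<and> (\<forall>g\<in>carrier G. \<sigma> g \<in> carrier_mat k k \<and> \<pi> g * P = P * \<sigma> g)"

lemma embeds_viaD:
  assumes "embeds_via G k \<sigma> n \<pi> P"
  shows "isometry_mat n k P" "P \<in> carrier_mat n k"
    "\<And>g. g \<in> carrier G \<Longrightarrow> \<sigma> g \<in> carrier_mat k k"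
    "\<And>g. g \<in> carrier G \<Longrightarrow> \<pi> g * P = P * \<sigma> g"
    "\<And>g. g \<in> carrier G \<Longrightarrow> \<sigma> g = P\<^sup>H * (\<pi> g * P)"
  using assms isometry_mat_cancel[of n k P _ k] by (auto simp: embeds_via_def isometry_mat_carrier)

lemma embeds_via_trans:
  assumes \<pi>: "\<And>g. g \<in> carrier G \<Longrightarrow> \<pi> g \<in> carrier_mat n n"
    and P: "embeds_via G k \<sigma> n \<pi> P" and Q: "embeds_via G l \<tau> k \<sigma> Q"
  shows "embeds_via G l \<tau> n \<pi> (P * Q)"
  unfolding embeds_via_def
proof (intro conjI ballI)
  note P = embeds_viaD[OF P] and Q = embeds_viaD[OF Q]
  show "isometry_mat n l (P * Q)" by (rule isometry_mat_mult[OF P(1) Q(1)])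
  fix g assume g: "g \<in> carrier G"
  show "\<tau> g \<in> carrier_mat l l" by (rule Q(3)[OF g])
  have "\<pi> g * (P * Q) = P * \<sigma> g * Q"
    using assoc_mult_mat[OF \<pi>[OF g] P(2) Q(2)] P(4)[OF g] by simp
  also have "\<dots> = P * (Q * \<tau> g)"
    using assoc_mult_mat[OF P(2) P(3)[OF g] Q(2)] Q(4)[OF g] by simp
  also have "\<dots> = P * Q * \<tau> g"
    using assoc_mult_mat[OF P(2) Q(2) Q(3)[OF g]] by simp
  finally show "\<pi> g * (P * Q) = P * Q * \<tau> g" .
qed

text \<open>
As \<open>P \<sigma>(g) = \<pi>(g) P\<close> is a product of isometries and \<open>P\<close> can be cancelled on the left, \<open>\<sigma>(g)\<close> is a square
isometry. Continuity is read off from \<open>\<sigma>(g) = P\<^sup>H \<pi>(g) P\<close>.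
\<close>

lemma unitary_rep_of_embeds_via:
  assumes G: "Group.group G" and \<pi>: "unitary_rep G T n \<pi>" and T: "topspace T = carrier G"
    and emb: "embeds_via G k \<sigma> n \<pi> P"
  shows "unitary_rep G T k \<sigma>"
  unfolding unitary_rep_def
proof (intro conjI ballI allI impI)
  interpret Group.group G by (rule G)
  note P = embeds_viaD[OF emb] and \<pi>c = unitary_rep_carrier[OF \<pi>]
  {
    fix g assume g: "g \<in> carrier G"
    have "isometry_mat n k (P * \<sigma> g)"
      using isometry_mat_mult[OF unitary_mat_isometry[OF unitary_rep_unitary[OF \<pi> g]] P(1)] P(4)[OF g] by simp
    then show "unitary_mat k (\<sigma> g)"
      by (intro isometry_mat_square isometry_mat_right_factor[OF P(1) P(3)[OF g]])
    fix h assume h: "h \<in> carrier G"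
    have "P * (\<sigma> g * \<sigma> h) = \<pi> g * P * \<sigma> h"
      using assoc_mult_mat[OF P(2) P(3)[OF g] P(3)[OF h]] P(4)[OF g] by simp
    also have "\<dots> = \<pi> g * (\<pi> h * P)"
      using assoc_mult_mat[OF \<pi>c[OF g] P(2) P(3)[OF h]] P(4)[OF h] by simp
    also have "\<dots> = P * \<sigma> (g \<otimes>\<^bsub>G\<^esub> h)"
      using assoc_mult_mat[OF \<pi>c[OF g] \<pi>c[OF h] P(2)] \<pi> g h P(4)[of "g \<otimes>\<^bsub>G\<^esub> h"]
      by (simp add: unitary_rep_def)
    finally show "\<sigma> (g \<otimes>\<^bsub>G\<^esub> h) = \<sigma> g * \<sigma> h"
      using isometry_mat_cancel[OF P(1) P(3)[of "g \<otimes>\<^bsub>G\<^esub> h"]]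
        isometry_mat_cancel[OF P(1) mult_carrier_mat[OF P(3)[OF g] P(3)[OF h]]] g h by simp
  }
  fix a b assume ab: "a < k" "b < k"
  have "continuous_map T euclidean (\<lambda>g. \<Sum>i<n. cnj (P $$ (i, a)) * (\<Sum>j<n. \<pi> g $$ (i, j) * P $$ (j, b)))"
    using \<pi> by (intro continuous_map_sum_complex continuous_map_mult_complex) (auto simp: unitary_rep_def)
  then show "continuous_map T euclidean (\<lambda>g. \<sigma> g $$ (a, b))"
  proof (rule continuous_map_eq)
    fix g assume "g \<in> topspace T"
    then have g: "g \<in> carrier G" by (simp add: T)
    have "\<sigma> g $$ (a, b) = (P\<^sup>H * (\<pi> g * P)) $$ (a, b)" using P(5)[OF g] by simp
    also have "\<dots> = (\<Sum>i<n. cnj (P $$ (i, a)) * (\<pi> g * P) $$ (i, b))"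
      using adj_mult_index[OF P(2) mult_carrier_mat[OF \<pi>c[OF g] P(2)] ab] .
    also have "\<dots> = (\<Sum>i<n. cnj (P $$ (i, a)) * (\<Sum>j<n. \<pi> g $$ (i, j) * P $$ (j, b)))"
      using ab P(2) \<pi>c[OF g] by (intro sum.cong refl) (auto simp: scalar_prod_def lessThan_atLeast0)
    finally show "(\<Sum>i<n. cnj (P $$ (i, a)) * (\<Sum>j<n. \<pi> g $$ (i, j) * P $$ (j, b))) = \<sigma> g $$ (a, b)" by simp
  qed
qed

lemma embeds_via_of_invariant:
  assumes \<pi>: "\<And>g. g \<in> carrier G \<Longrightarrow> \<pi> g \<in> carrier_mat n n"
    and W: "VectorSpace.subspace class_ring W (module_vec TYPE(complex) n)"
    and inv: "\<And>g w. g \<in> carrier G \<Longrightarrow> w \<in> W \<Longrightarrow> \<pi> g *\<^sub>v w \<in> W"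
  obtains k \<sigma> P where "embeds_via G k \<sigma> n \<pi> P" "\<And>u. u \<in> carrier_vec k \<Longrightarrow> P *\<^sub>v u \<in> W"
    "\<And>w. w \<in> W \<Longrightarrow> P *\<^sub>v (P\<^sup>H *\<^sub>v w) = w"
proof -
  obtain k P where P: "isometry_mat n k P" "\<And>u. u \<in> carrier_vec k \<Longrightarrow> P *\<^sub>v u \<in> W"
    "\<And>w. w \<in> W \<Longrightarrow> P *\<^sub>v (P\<^sup>H *\<^sub>v w) = w"
    using isometry_onto_subspace[OF W] by blast
  note Pc = isometry_mat_carrier[OF P(1)]
  define \<sigma> where "\<sigma> g = P\<^sup>H * (\<pi> g * P)" for g
  have "embeds_via G k \<sigma> n \<pi> P"
    unfolding embeds_via_def
  proof (intro conjI ballI)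
    fix g assume g: "g \<in> carrier G"
    have c: "\<pi> g * P \<in> carrier_mat n k" using \<pi>[OF g] Pc by simp
    show "\<sigma> g \<in> carrier_mat k k" unfolding \<sigma>_def by (rule mult_carrier_mat[OF adj_carrier[OF Pc] c])
    show "\<pi> g * P = P * \<sigma> g"
    proof (rule mat_eqI_mult_vec[OF c])
      show "P * \<sigma> g \<in> carrier_mat n k" using Pc \<open>\<sigma> g \<in> carrier_mat k k\<close> by simp
      fix u :: "complex vec" assume u: "u \<in> carrier_vec k"
      have "(\<pi> g * P) *\<^sub>v u \<in> W" 
        using inv[OF g P(2)[OF u]] \<pi>[OF g] Pc u by (simp add: assoc_mult_mat_vec[of _ n n])
      from P(3)[OF this] show "\<pi> g * P *\<^sub>v u = P * \<sigma> g *\<^sub>v u"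
        using assoc_mult_mat_vec[OF Pc \<open>\<sigma> g \<in> carrier_mat k k\<close> u]
          assoc_mult_mat_vec[OF adj_carrier[OF Pc] c u] by (simp only: \<sigma>_def)
    qed
  qed (rule P(1))
  with P show thesis using that by blast
qed

lemma intertwiner_adj:
  assumes U: "unitary_mat n U" and V: "unitary_mat k V" and X: "X \<in> carrier_mat n k"
    and eq: "U * X = X * V"
  shows "X\<^sup>H * U = V * X\<^sup>H"
proof -
  have c: "U \<in> carrier_mat n n" "V \<in> carrier_mat k k" "X\<^sup>H \<in> carrier_mat k n"
    "U\<^sup>H \<in> carrier_mat n n" "V\<^sup>H \<in> carrier_mat k k"
    using U V X by (auto simp: unitary_mat_def)
  have "X\<^sup>H * U\<^sup>H = V\<^sup>H * X\<^sup>H"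
    using arg_cong[OF eq, of mat_adjoint] by (simp add: adj_mult[OF c(1) X] adj_mult[OF X c(2)])
  then have *: "V * (X\<^sup>H * U\<^sup>H) = V * V\<^sup>H * X\<^sup>H"
    using assoc_mult_mat[OF c(2,5,3)] by (simp only:)
  have "X\<^sup>H = V * V\<^sup>H * X\<^sup>H"
    using V left_mult_one_mat[OF c(3)] by (simp only: unitary_mat_def)
  then have "X\<^sup>H * U = V * (X\<^sup>H * U\<^sup>H) * U" by (simp only: *)
  also have "\<dots> = V * (X\<^sup>H * (U\<^sup>H * U))"
    using assoc_mult_mat[OF c(2) mult_carrier_mat[OF c(3,4)] c(1)] assoc_mult_mat[OF c(3,4,1)]
    by (simp only:)
  also have "\<dots> = V * X\<^sup>H" using U right_mult_one_mat[OF c(3)] by (simp only: unitary_mat_def)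
  finally show ?thesis .
qed

text \<open>
The orthogonal complement of an invariant subspace is invariant, because the adjoint of an
intertwiner of unitary representations is again an intertwiner.
\<close>

lemma embeds_via_complement:
  assumes \<pi>: "\<And>g. g \<in> carrier G \<Longrightarrow> unitary_mat n (\<pi> g)"
    and \<sigma>: "\<And>g. g \<in> carrier G \<Longrightarrow> unitary_mat k (\<sigma> g)"
    and emb: "embeds_via G k \<sigma> n \<pi> P"
  obtains l \<tau> Q where "embeds_via G l \<tau> n \<pi> Q" "Q\<^sup>H * P = 0\<^sub>m l k" "P * P\<^sup>H + Q * Q\<^sup>H = 1\<^sub>m n"
proof -
  note P = embeds_viaD[OF emb]
  obtain l Q where Q: "isometry_mat n l Q" and PQ: "P\<^sup>H * Q = 0\<^sub>m k l" and QP: "Q\<^sup>H * P = 0\<^sub>m l k"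
    and one: "P * P\<^sup>H + Q * Q\<^sup>H = 1\<^sub>m n"
    using isometry_mat_complement[OF P(1)] .
  note Qc = isometry_mat_carrier[OF Q]
  define \<tau> where "\<tau> g = Q\<^sup>H * (\<pi> g * Q)" for g
  have "embeds_via G l \<tau> n \<pi> Q"
    unfolding embeds_via_def
  proof (intro conjI ballI)
    fix g assume g: "g \<in> carrier G"
    have \<pi>c: "\<pi> g \<in> carrier_mat n n" using \<pi>[OF g] by (rule unitary_mat_carrier)
    have c: "\<pi> g * Q \<in> carrier_mat n l" using \<pi>c Qc by simp
    show "\<tau> g \<in> carrier_mat l l" unfolding \<tau>_def by (rule mult_carrier_mat[OF adj_carrier[OF Qc] c])
    have "P\<^sup>H * (\<pi> g * Q) = P\<^sup>H * \<pi> g * Q"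
      using assoc_mult_mat[OF adj_carrier[OF P(2)] \<pi>c Qc] by simp
    also have "\<dots> = \<sigma> g * P\<^sup>H * Q"
      using intertwiner_adj[OF \<pi>[OF g] \<sigma>[OF g] P(2) P(4)[OF g]] by simp
    also have "\<dots> = \<sigma> g * (P\<^sup>H * Q)"
      using assoc_mult_mat[OF P(3)[OF g] adj_carrier[OF P(2)] Qc] .
    also have "\<dots> = 0\<^sub>m k l" using P(3)[OF g] by (simp add: PQ)
    finally have z: "P\<^sup>H * (\<pi> g * Q) = 0\<^sub>m k l" .
    have "\<pi> g * Q = (P * P\<^sup>H + Q * Q\<^sup>H) * (\<pi> g * Q)"
      using left_mult_one_mat[OF c] by (simp only: one)
    also have "\<dots> = P * P\<^sup>H * (\<pi> g * Q) + Q * Q\<^sup>H * (\<pi> g * Q)"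
      using c P(2) Qc by (intro add_mult_distrib_mat[of _ n n]) auto
    also have "\<dots> = P * (P\<^sup>H * (\<pi> g * Q)) + Q * \<tau> g"
      unfolding \<tau>_def using assoc_mult_mat[OF P(2) adj_carrier[OF P(2)] c]
        assoc_mult_mat[OF Qc adj_carrier[OF Qc] c] by simp
    also have "\<dots> = Q * \<tau> g" using P(2) Qc \<open>\<tau> g \<in> carrier_mat l l\<close> by (simp add: z)
    finally show "\<pi> g * Q = Q * \<tau> g" .
  qed (rule Q)
  with QP one show thesis using that by blast
qed

text \<open>
Induction on the dimension: a reducible representation is the sum of two proper blocks, and if
neither block separated \<open>g\<close> from \<open>g'\<close> then \<open>\<pi>(g) = P \<sigma>(g) P\<^sup>H + Q \<tau>(g) Q\<^sup>H\<close> would equal \<open>\<pi>(g')\<close>.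
\<close>

lemma exists_separating_irreducible_subrep:
  assumes G: "Group.group G" and T: "topspace T = carrier G" and g: "g \<in> carrier G" "g' \<in> carrier G"
  shows "unitary_rep G T n \<pi> \<Longrightarrow> \<pi> g \<noteq> \<pi> g' \<Longrightarrow>
     \<exists>k \<sigma> P. (k, \<sigma>) \<in> fd_irreps G T \<and> embeds_via G k \<sigma> n \<pi> P \<and> \<sigma> g \<noteq> \<sigma> g'"
proof (induction n arbitrary: \<pi> rule: less_induct)
  case (less n)
  note \<pi> = less.prems(1) and ne = less.prems(2)
  note \<pi>c = unitary_rep_carrier[OF \<pi>] and \<pi>u = unitary_rep_unitary[OF \<pi>]
  have n: "n \<ge> 1"
  proof (rule ccontr)
    assume "\<not> n \<ge> 1"
    then have "\<pi> g = \<pi> g'" using \<pi>c[OF g(1)] \<pi>c[OF g(2)] by (intro eq_matI) auto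
    with ne show False by simp
  qed
  show ?case
  proof (cases "irreducible_rep G n \<pi>")
    case True
    have "embeds_via G n \<pi> n \<pi> (1\<^sub>m n)"
      unfolding embeds_via_def
    proof (intro conjI ballI)
      fix h assume "h \<in> carrier G"
      from \<pi>c[OF this] show "\<pi> h \<in> carrier_mat n n" "\<pi> h * 1\<^sub>m n = 1\<^sub>m n * \<pi> h"
        by (simp_all only: left_mult_one_mat right_mult_one_mat)
    qed (rule unitary_mat_isometry[OF unitary_mat_one])
    then show ?thesis using \<pi> True ne by (auto simp: fd_irreps_def)
  next
    case False
    then obtain W where W: "VectorSpace.subspace class_ring W (module_vec TYPE(complex) n)"
      and inv: "\<And>h w. h \<in> carrier G \<Longrightarrow> w \<in> W \<Longrightarrow> \<pi> h *\<^sub>v w \<in> W"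
      and nontriv: "W \<noteq> {0\<^sub>v n}" "W \<noteq> carrier_vec n"
      using n unfolding irreducible_rep_def by blast
    have W': "W \<subseteq> carrier_vec n" "0\<^sub>v n \<in> W" using W by (auto simp: subspace_module_vec_iff)
    obtain k \<sigma> P where emb: "embeds_via G k \<sigma> n \<pi> P"
      and PW: "\<And>u. u \<in> carrier_vec k \<Longrightarrow> P *\<^sub>v u \<in> W"
      and PP: "\<And>w. w \<in> W \<Longrightarrow> P *\<^sub>v (P\<^sup>H *\<^sub>v w) = w"
      using embeds_via_of_invariant[of G \<pi> n W, OF \<pi>c W inv] by blast
    note P = embeds_viaD[OF emb]
    have \<sigma>: "unitary_rep G T k \<sigma>" by (rule unitary_rep_of_embeds_via[OF G \<pi> T emb])
    obtain l \<tau> Q where emb': "embeds_via G l \<tau> n \<pi> Q" and QP: "Q\<^sup>H * P = 0\<^sub>m l k"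
      and one: "P * P\<^sup>H + Q * Q\<^sup>H = 1\<^sub>m n"
      using embeds_via_complement[of G n \<pi> k \<sigma>, OF \<pi>u unitary_rep_unitary[OF \<sigma>] emb] by blast
    note Q = embeds_viaD[OF emb']
    have \<tau>: "unitary_rep G T l \<tau>" by (rule unitary_rep_of_embeds_via[OF G \<pi> T emb'])
    have "k \<noteq> n"
    proof
      assume "k = n"
      have "v \<in> W" if v: "v \<in> carrier_vec n" for v
      proof -
        have "P * P\<^sup>H = 1\<^sub>m n" using isometry_mat_square P(1) \<open>k = n\<close> by (simp add: unitary_mat_def)
        then have "v = P *\<^sub>v (P\<^sup>H *\<^sub>v v)"
          using assoc_mult_mat_vec[OF P(2) adj_carrier[OF P(2)] v] one_mult_mat_vec[OF v] by simp
        moreover have "P\<^sup>H *\<^sub>v v \<in> carrier_vec k" using mult_mat_vec_carrier[OF adj_carrier[OF P(2)] v] .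
        ultimately show ?thesis using PW by metis
      qed
      with W' nontriv show False by blast
    qed
    have "l \<noteq> n"
    proof
      assume "l = n"
      then have "Q * Q\<^sup>H = 1\<^sub>m n" using isometry_mat_square Q(1) by (simp add: unitary_mat_def)
      then have "P = Q * Q\<^sup>H * P" using P(2) by simp
      also have "\<dots> = Q * (Q\<^sup>H * P)" using assoc_mult_mat[OF Q(2) adj_carrier[OF Q(2)] P(2)] .
      finally have "P = 0\<^sub>m n k" using Q(2) by (simp add: QP)
      have "w = 0\<^sub>v n" if w: "w \<in> W" for w
      proof -
        have "P\<^sup>H *\<^sub>v w \<in> carrier_vec k" using mult_mat_vec_carrier[OF adj_carrier[OF P(2)]] w W' by blast
        then have "P *\<^sub>v (P\<^sup>H *\<^sub>v w) = 0\<^sub>v n" unfolding \<open>P = 0\<^sub>m n k\<close> by (intro eq_vecI) auto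
        then show ?thesis using PP[OF w] by simp
      qed
      with W' nontriv show False by blast
    qed
    have less': "k < n" "l < n"
      using \<open>k \<noteq> n\<close> \<open>l \<noteq> n\<close> isometry_mat_dim_le[OF P(1)] isometry_mat_dim_le[OF Q(1)] by auto
    have decomp: "\<pi> h = P * \<sigma> h * P\<^sup>H + Q * \<tau> h * Q\<^sup>H" if h: "h \<in> carrier G" for h
    proof -
      have "\<pi> h = \<pi> h * (P * P\<^sup>H + Q * Q\<^sup>H)" using \<pi>c[OF h] by (simp add: one)
      also have "\<dots> = \<pi> h * (P * P\<^sup>H) + \<pi> h * (Q * Q\<^sup>H)"
        using \<pi>c[OF h] P(2) Q(2) by (intro mult_add_distrib_mat[of _ n n]) auto
      also have "\<dots> = \<pi> h * P * P\<^sup>H + \<pi> h * Q * Q\<^sup>H"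
        using assoc_mult_mat[OF \<pi>c[OF h] P(2) adj_carrier[OF P(2)]]
          assoc_mult_mat[OF \<pi>c[OF h] Q(2) adj_carrier[OF Q(2)]] by simp
      finally show ?thesis by (simp add: P(4)[OF h] Q(4)[OF h])
    qed
    have "\<sigma> g \<noteq> \<sigma> g' \<or> \<tau> g \<noteq> \<tau> g'" using decomp[OF g(1)] decomp[OF g(2)] ne by metis
    then show ?thesis
    proof
      assume "\<sigma> g \<noteq> \<sigma> g'"
      from less.IH[OF less'(1) \<sigma> this] show ?thesis
        using embeds_via_trans[OF \<pi>c emb] by blast
    next
      assume "\<tau> g \<noteq> \<tau> g'"
      from less.IH[OF less'(2) \<tau> this] show ?thesis
        using embeds_via_trans[OF \<pi>c emb'] by blast
    qed
  qed
qed

section \<open>Schur's lemma\<close>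

text \<open>
An eigenspace of \<open>A\<close> is a nonzero invariant subspace.
\<close>

lemma irreducible_commutant_scalar:
  assumes irr: "irreducible_rep G n \<pi>" and \<pi>: "\<And>g. g \<in> carrier G \<Longrightarrow> \<pi> g \<in> carrier_mat n n"
    and A: "A \<in> carrier_mat n n" and comm: "\<And>g. g \<in> carrier G \<Longrightarrow> A * \<pi> g = \<pi> g * A"
  shows "\<exists>c. A = c \<cdot>\<^sub>m 1\<^sub>m n"
proof -
  have n: "n \<ge> 1" using irr by (simp add: irreducible_rep_def)
  then obtain c where "eigenvalue A c"
    using spectrum_non_empty[OF A] by (auto simp: spectrum_def)
  then obtain v where v: "v \<in> carrier_vec n" "v \<noteq> 0\<^sub>v n" "A *\<^sub>v v = c \<cdot>\<^sub>v v"
    using A by (auto simp: eigenvalue_def eigenvector_def)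
  define W where "W = {w \<in> carrier_vec n. A *\<^sub>v w = c \<cdot>\<^sub>v w}"
  have "A *\<^sub>v 0\<^sub>v n = 0\<^sub>v n" using A by (intro eq_vecI) auto
  then have "VectorSpace.subspace class_ring W (module_vec TYPE(complex) n)"
    unfolding subspace_module_vec_iff W_def using A
    by (auto simp: mult_add_distrib_mat_vec[of _ n n] mult_mat_vec[of _ n n] smult_add_distrib_vec[of _ n]
        smult_smult_assoc mult.commute)
  moreover have "\<pi> g *\<^sub>v w \<in> W" if g: "g \<in> carrier G" and w: "w \<in> W" for g w
  proof -
    have wc: "w \<in> carrier_vec n" and Aw: "A *\<^sub>v w = c \<cdot>\<^sub>v w" using w by (auto simp: W_def)
    have "A *\<^sub>v (\<pi> g *\<^sub>v w) = \<pi> g *\<^sub>v (A *\<^sub>v w)"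
      using comm[OF g] assoc_mult_mat_vec[OF A \<pi>[OF g] wc] assoc_mult_mat_vec[OF \<pi>[OF g] A wc] by simp
    also have "\<dots> = c \<cdot>\<^sub>v (\<pi> g *\<^sub>v w)" unfolding Aw by (rule mult_mat_vec[OF \<pi>[OF g] wc])
    finally show ?thesis using mult_mat_vec_carrier[OF \<pi>[OF g] wc] by (simp add: W_def)
  qed
  ultimately have "W = {0\<^sub>v n} \<or> W = carrier_vec n"
    using irr unfolding irreducible_rep_def by blast
  moreover have "v \<in> W" using v by (simp add: W_def)
  ultimately have "W = carrier_vec n" using v by blast
  have "A = c \<cdot>\<^sub>m 1\<^sub>m n"
  proof (rule mat_eqI_mult_vec[OF A])
    fix u :: "complex vec" assume "u \<in> carrier_vec n"
    then have "A *\<^sub>v u = c \<cdot>\<^sub>v u" using \<open>W = carrier_vec n\<close> by (auto simp: W_def)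
    also have "\<dots> = c \<cdot>\<^sub>m 1\<^sub>m n *\<^sub>v u"
      using \<open>u \<in> carrier_vec n\<close> by (intro eq_vecI) (auto simp: scalar_prod_left_unit)
    finally show "A *\<^sub>v u = c \<cdot>\<^sub>m 1\<^sub>m n *\<^sub>v u" .
  qed simp
  then show ?thesis ..
qed

text \<open>
Both \<open>X\<^sup>H X\<close> and \<open>X X\<^sup>H\<close> commute with irreducible representations, so they are scalars \<open>c\<close> and \<open>d\<close>;
computing \<open>X X\<^sup>H X\<close> in two ways gives \<open>c = d\<close>. As \<open>c\<close> is the squared length of a nonzero column of \<open>X\<close>, it is
positive, and \<open>X / \<surd>c\<close> is unitary.
\<close>

lemma Schur_intertwiner:
  assumes \<sigma>: "(n, \<sigma>) \<in> fd_irreps G T" and \<tau>: "(m, \<tau>) \<in> fd_irreps G T"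
    and X: "X \<in> carrier_mat m n" and int: "\<And>g. g \<in> carrier G \<Longrightarrow> \<tau> g * X = X * \<sigma> g"
    and "X \<noteq> 0\<^sub>m m n"
  shows "((n, \<sigma>), (m, \<tau>)) \<in> unitary_equivalence G T"
proof -
  have reps: "unitary_rep G T n \<sigma>" "unitary_rep G T m \<tau>" "irreducible_rep G n \<sigma>" "irreducible_rep G m \<tau>"
    using \<sigma> \<tau> by (auto simp: fd_irreps_def)
  note \<sigma>c = unitary_rep_carrier[OF reps(1)] and \<tau>c = unitary_rep_carrier[OF reps(2)]
  note XH = adj_carrier[OF X]
  have int': "X\<^sup>H * \<tau> g = \<sigma> g * X\<^sup>H" if g: "g \<in> carrier G" for g
    by (rule intertwiner_adj[OF unitary_rep_unitary[OF reps(2) g] unitary_rep_unitary[OF reps(1) g] X int[OF g]])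
  have "X\<^sup>H * X * \<sigma> g = \<sigma> g * (X\<^sup>H * X)" if g: "g \<in> carrier G" for g
    using assoc_mult_mat[OF XH X \<sigma>c[OF g]] assoc_mult_mat[OF XH \<tau>c[OF g] X]
      assoc_mult_mat[OF \<sigma>c[OF g] XH X] int[OF g] int'[OF g] by simp
  then obtain c where c: "X\<^sup>H * X = c \<cdot>\<^sub>m 1\<^sub>m n"
    using irreducible_commutant_scalar[OF reps(3) \<sigma>c mult_carrier_mat[OF XH X]] by blast
  have "X * X\<^sup>H * \<tau> g = \<tau> g * (X * X\<^sup>H)" if g: "g \<in> carrier G" for g
    using assoc_mult_mat[OF X XH \<tau>c[OF g]] assoc_mult_mat[OF X \<sigma>c[OF g] XH]
      assoc_mult_mat[OF \<tau>c[OF g] X XH] int[OF g] int'[OF g] by simp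
  then obtain d where d: "X * X\<^sup>H = d \<cdot>\<^sub>m 1\<^sub>m m"
    using irreducible_commutant_scalar[OF reps(4) \<tau>c mult_carrier_mat[OF X XH]] by blast
  obtain i j where ij: "i < m" "j < n" "X $$ (i, j) \<noteq> 0"
    using \<open>X \<noteq> 0\<^sub>m m n\<close> X by (metis carrier_matD eq_matI index_zero_mat)
  have "d \<cdot>\<^sub>m X = X * X\<^sup>H * X"
    unfolding d using mult_smult_assoc_mat[OF one_carrier_mat X, of d] left_mult_one_mat[OF X] by simp
  also have "\<dots> = X * (X\<^sup>H * X)" by (rule assoc_mult_mat[OF X XH X])
  also have "\<dots> = c \<cdot>\<^sub>m X" 
    unfolding c using mult_smult_distrib[OF X one_carrier_mat, of c] right_mult_one_mat[OF X] by simp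
  finally have "(d \<cdot>\<^sub>m X) $$ (i, j) = (c \<cdot>\<^sub>m X) $$ (i, j)" by simp
  then have "d = c" using ij X by simp
  define s where "s = (\<Sum>i<m. (cmod (X $$ (i, j)))\<^sup>2)"
  have "c = (\<Sum>i<m. cnj (X $$ (i, j)) * X $$ (i, j))"
    using adj_mult_index[OF X X ij(2) ij(2)] ij by (simp add: c)
  also have "\<dots> = of_real s"
    unfolding s_def of_real_sum by (intro sum.cong refl) (metis complex_norm_square mult.commute)
  finally have cs: "c = of_real s" .
  have s: "s > 0" unfolding s_def using ij by (auto intro!: sum_pos2[of _ i])
  define r where "r = complex_of_real (1 / sqrt s)"
  have rr: "cnj r * r * c = 1" "r * cnj r * c = 1"
    using s unfolding r_def cs by (simp_all flip: of_real_mult)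
  define U where "U = r \<cdot>\<^sub>m X"
  have Uc: "U \<in> carrier_mat m n" using X by (simp add: U_def)
  have UH: "U\<^sup>H = cnj r \<cdot>\<^sub>m X\<^sup>H" unfolding U_def using X by (intro eq_matI) auto
  have "U\<^sup>H * U = cnj r \<cdot>\<^sub>m (r \<cdot>\<^sub>m (c \<cdot>\<^sub>m 1\<^sub>m n))"
    unfolding UH unfolding U_def
    using mult_smult_assoc_mat[OF XH smult_carrier_mat[OF X]] mult_smult_distrib[OF XH X] c by simp
  then have UHU: "U\<^sup>H * U = 1\<^sub>m n" using rr(1) by (intro eq_matI) (auto simp: mult.assoc)
  have "U * U\<^sup>H = r \<cdot>\<^sub>m (cnj r \<cdot>\<^sub>m (c \<cdot>\<^sub>m 1\<^sub>m m))"
    unfolding UH unfolding U_def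
    using mult_smult_assoc_mat[OF X smult_carrier_mat[OF XH]] mult_smult_distrib[OF X XH] d \<open>d = c\<close>
    by simp
  then have UUH: "U * U\<^sup>H = 1\<^sub>m m" using rr(2) by (intro eq_matI) (auto simp: mult.assoc)
  have "isometry_mat m n U" "isometry_mat n m (U\<^sup>H)"
    using UHU UUH Uc by (auto simp: isometry_mat_def)
  then have nm: "m = n" using isometry_mat_dim_le by (metis le_antisym)
  show ?thesis
    unfolding nm
  proof (rule unitary_equivalenceI[OF \<sigma> _])
    show "(n, \<tau>) \<in> fd_irreps G T" using \<tau> nm by simp
    show "unitary_mat n U" using UHU UUH Uc nm by (simp add: unitary_mat_def)
    fix g assume g: "g \<in> carrier G"
    have "\<tau> g * U = U * \<sigma> g"
      unfolding U_def using int[OF g] mult_smult_distrib[OF \<tau>c[OF g] X] mult_smult_assoc_mat[OF X \<sigma>c[OF g]] by simp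
    then have "U * \<sigma> g * U\<^sup>H = \<tau> g * (U * U\<^sup>H)"
      using assoc_mult_mat[OF \<tau>c[OF g] Uc adj_carrier[OF Uc]] by simp
    then show "\<tau> g = U * \<sigma> g * U\<^sup>H" using \<tau>c[OF g] by (simp add: UUH)
  qed
qed

text \<open>
For inequivalent constituents embedded by \<open>P\<close> and \<open>P'\<close> the matrix \<open>P\<^sup>H P'\<close> is an intertwiner, so it
vanishes by Schur's lemma. Choosing one column from each embedding yields orthonormal vectors in
dimension \<open>n\<close>, so there are at most \<open>n\<close> classes.
\<close>

lemma finite_constituents:
  assumes \<rho>: "\<And>g. g \<in> carrier G \<Longrightarrow> unitary_mat n (\<rho> g)"
  shows "finite {unitary_equivalence G T `` {(k, \<sigma>)} | k \<sigma>.
     (k, \<sigma>) \<in> fd_irreps G T \<and> (\<exists>P. embeds_via G k \<sigma> n \<rho> P)}" (is "finite ?C")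
proof (rule ccontr)
  assume "infinite ?C"
  then obtain F where F: "F \<subseteq> ?C" "finite F" "card F = Suc n"
    using infinite_arbitrarily_large by blast
  then obtain f where f: "bij_betw f {..<Suc n} F"
    using ex_bij_betw_nat_finite[of F] by (auto simp: lessThan_atLeast0)
  have "\<forall>i\<in>{..<Suc n}. \<exists>k \<sigma> P. f i = unitary_equivalence G T `` {(k, \<sigma>)} \<and>
      (k, \<sigma>) \<in> fd_irreps G T \<and> embeds_via G k \<sigma> n \<rho> P"
  proof
    fix i assume "i \<in> {..<Suc n}"
    then have "f i \<in> ?C" using f F(1) by (auto simp: bij_betw_def)
    then show "\<exists>k \<sigma> P. f i = unitary_equivalence G T `` {(k, \<sigma>)} \<and>
      (k, \<sigma>) \<in> fd_irreps G T \<and> embeds_via G k \<sigma> n \<rho> P" by blast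
  qed
  then obtain k \<sigma> P where kP: "\<And>i. i \<in> {..<Suc n} \<Longrightarrow> f i = unitary_equivalence G T `` {(k i, \<sigma> i)}"
    "\<And>i. i \<in> {..<Suc n} \<Longrightarrow> (k i, \<sigma> i) \<in> fd_irreps G T"
    "\<And>i. i \<in> {..<Suc n} \<Longrightarrow> embeds_via G (k i) (\<sigma> i) n \<rho> (P i)"
    by metis
  have k: "0 < k i" if "i < Suc n" for i
    using kP(2)[of i] that by (simp add: fd_irreps_def irreducible_rep_def)
  have \<sigma>u: "unitary_mat (k i) (\<sigma> i g)" if "i < Suc n" "g \<in> carrier G" for i g
    using kP(2)[of i] that by (simp add: fd_irreps_def unitary_rep_def)
  have orth: "(P i)\<^sup>H * P j = 0\<^sub>m (k i) (k j)" if i: "i < Suc n" and j: "j < Suc n" and "i \<noteq> j" for i j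
  proof (rule ccontr)
    have i': "i \<in> {..<Suc n}" and j': "j \<in> {..<Suc n}" using i j by auto
    note Pi = embeds_viaD[OF kP(3)[OF i']] and Pj = embeds_viaD[OF kP(3)[OF j']]
    assume ne: "(P i)\<^sup>H * P j \<noteq> 0\<^sub>m (k i) (k j)"
    have int: "\<sigma> i g * ((P i)\<^sup>H * P j) = (P i)\<^sup>H * P j * \<sigma> j g" if g: "g \<in> carrier G" for g
    proof -
      have *: "(P i)\<^sup>H * \<rho> g = \<sigma> i g * (P i)\<^sup>H"
        by (rule intertwiner_adj[OF \<rho>[OF g] \<sigma>u[OF i g] Pi(2) Pi(4)[OF g]])
      show ?thesis
        using assoc_mult_mat[OF Pi(3)[OF g] adj_carrier[OF Pi(2)] Pj(2)] *
          assoc_mult_mat[OF adj_carrier[OF Pi(2)] unitary_mat_carrier[OF \<rho>[OF g]] Pj(2)] Pj(4)[OF g]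
          assoc_mult_mat[OF adj_carrier[OF Pi(2)] Pj(2) Pj(3)[OF g]] by simp
    qed
    have "((k j, \<sigma> j), (k i, \<sigma> i)) \<in> unitary_equivalence G T"
      by (rule Schur_intertwiner[OF kP(2)[OF j'] kP(2)[OF i'] _ int ne])
         (use Pi(2) Pj(2) in auto)
    then have "f j = f i"
      using kP(1)[OF i'] kP(1)[OF j'] equiv_class_eq[OF equiv_unitary_equivalence] by metis
    then show False using f i' j' \<open>i \<noteq> j\<close> by (auto simp: bij_betw_def inj_on_def)
  qed
  define V where "V = mat n (Suc n) (\<lambda>(a, i). P i $$ (a, 0))"
  have Vc: "V \<in> carrier_mat n (Suc n)" by (simp add: V_def)
  have "V\<^sup>H * V = 1\<^sub>m (Suc n)"
  proof (rule eq_matI)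
    fix i j assume "i < dim_row (1\<^sub>m (Suc n) :: complex mat)" "j < dim_col (1\<^sub>m (Suc n) :: complex mat)"
    then have i: "i < Suc n" and j: "j < Suc n" by auto
    then have i': "i \<in> {..<Suc n}" and j': "j \<in> {..<Suc n}" by auto
    note Pi = embeds_viaD[OF kP(3)[OF i']] and Pj = embeds_viaD[OF kP(3)[OF j']]
    have "(V\<^sup>H * V) $$ (i, j) = (\<Sum>a<n. cnj (P i $$ (a, 0)) * P j $$ (a, 0))"
      unfolding adj_mult_index[OF Vc Vc i j] by (rule sum.cong) (use i j in \<open>auto simp: V_def\<close>)
    also have "\<dots> = ((P i)\<^sup>H * P j) $$ (0, 0)"
      using adj_mult_index[OF Pi(2) Pj(2) k[OF i] k[OF j]] by simp
    also have "\<dots> = (if i = j then 1 else 0)"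
      using orth[OF i j] isometry_mat_adj_mult[OF Pi(1)] k[OF i] k[OF j] by auto
    finally show "(V\<^sup>H * V) $$ (i, j) = 1\<^sub>m (Suc n) $$ (i, j)" using i j by simp
  qed (use Vc in auto)
  then have "isometry_mat n (Suc n) V" using Vc by (simp add: isometry_mat_def)
  then show False using isometry_mat_dim_le by fastforce
qed

section \<open>Unitary representations from invariant Gram kernels\<close>

text \<open>
Formal linear combinations of points, evaluated through \<open>\<phi>\<close>. Keeping them as lists separates the
coefficients from \<open>\<phi>\<close>, so the same combination can be evaluated after the points have been moved.
\<close>

definition lin_comb :: "('x \<Rightarrow> nat \<Rightarrow> complex) \<Rightarrow> (complex \<times> 'x) list \<Rightarrow> nat \<Rightarrow> complex" where
  "lin_comb \<phi> ps i = (\<Sum>(c, x)\<leftarrow>ps. c * \<phi> x i)"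

lemma lin_comb_simps [simp]:
  "lin_comb \<phi> [] i = 0"
  "lin_comb \<phi> (p # ps) i = fst p * \<phi> (snd p) i + lin_comb \<phi> ps i"
  "lin_comb \<phi> (ps @ qs) i = lin_comb \<phi> ps i + lin_comb \<phi> qs i"
  by (auto simp: lin_comb_def case_prod_beta)

lemma lin_comb_scale: "lin_comb \<phi> (map (\<lambda>(c, x). (d * c, x)) ps) i = d * lin_comb \<phi> ps i"
  by (induction ps) (auto simp: algebra_simps)

lemma lin_comb_map: "lin_comb \<phi> (map (\<lambda>(c, x). (c, f x)) ps) i = lin_comb (\<lambda>x. \<phi> (f x)) ps i"
  by (induction ps) auto

lemma lin_comb_cong:
  assumes "\<And>c x. (c, x) \<in> set ps \<Longrightarrow> \<phi> x i = \<psi> x i"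
  shows "lin_comb \<phi> ps i = lin_comb \<psi> ps i"
  using assms by (induction ps) fastforce+

lemma lin_comb_concat:
  "lin_comb \<phi> (concat (map f [0..<k])) i = (\<Sum>b<k. lin_comb \<phi> (f b) i)"
  by (induction k) auto

lemma continuous_map_lin_comb:
  assumes "\<And>c x. (c, x) \<in> set ps \<Longrightarrow> continuous_map T euclidean (\<lambda>g. \<phi> g x i)"
  shows "continuous_map T euclidean (\<lambda>g. lin_comb (\<phi> g) ps i)"
  using assms
proof (induction ps)
  case (Cons p ps)
  obtain c x where p: "p = (c, x)" by (cases p)
  have "continuous_map T euclidean (\<lambda>g. c * \<phi> g x i)"
    using Cons.prems[of c x] by (intro continuous_map_mult_complex) (auto simp: p)
  moreover have "continuous_map T euclidean (\<lambda>g. lin_comb (\<phi> g) ps i)"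
    using Cons by auto
  ultimately show ?case by (simp add: p continuous_map_atin tendsto_add)
qed simp

lemma gram_lin_comb:
  assumes gram: "\<And>x y. x \<in> X \<Longrightarrow> y \<in> X \<Longrightarrow>
      (\<Sum>i<D. cnj (\<phi> x i) * \<phi> y i) = (\<Sum>i<D. cnj (\<psi> x i) * \<psi> y i)"
    and "snd ` set ps \<subseteq> X" and "snd ` set qs \<subseteq> X"
  shows "(\<Sum>i<D. cnj (lin_comb \<phi> ps i) * lin_comb \<phi> qs i)
       = (\<Sum>i<D. cnj (lin_comb \<psi> ps i) * lin_comb \<psi> qs i)"
  using assms(2)
proof (induction ps)
  case (Cons p ps)
  then have p: "snd p \<in> X" by simp
  have "(\<Sum>i<D. cnj (\<phi> (snd p) i) * lin_comb \<phi> qs i) = (\<Sum>i<D. cnj (\<psi> (snd p) i) * lin_comb \<psi> qs i)"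
    using assms(3)
  proof (induction qs)
    case (Cons q qs)
    have "(\<Sum>i<D. cnj (f (snd p) i) * lin_comb f (q # qs) i)
        = fst q * (\<Sum>i<D. cnj (f (snd p) i) * f (snd q) i) + (\<Sum>i<D. cnj (f (snd p) i) * lin_comb f qs i)" for f
      by (simp add: algebra_simps sum.distrib sum_distrib_left)
    then show ?case using Cons gram[OF p, of "snd q"] by simp
  qed simp
  moreover have "(\<Sum>i<D. cnj (lin_comb f (p # ps) i) * lin_comb f qs i)
      = cnj (fst p) * (\<Sum>i<D. cnj (f (snd p) i) * lin_comb f qs i)
        + (\<Sum>i<D. cnj (lin_comb f ps i) * lin_comb f qs i)" for f
    by (simp add: algebra_simps sum.distrib sum_distrib_left)
  ultimately show ?case using Cons by simp
qed simp

text \<open>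
Linear relations between vectors depend only on their Gram matrix, because a relation says that a
certain combination has norm zero.
\<close>

lemma lin_comb_relation_transfer:
  assumes gram: "\<And>x y. x \<in> X \<Longrightarrow> y \<in> X \<Longrightarrow>
      (\<Sum>i<D. cnj (\<phi> x i) * \<phi> y i) = (\<Sum>i<D. cnj (\<psi> x i) * \<psi> y i)"
    and X: "snd ` set ps \<subseteq> X" "snd ` set qs \<subseteq> X"
    and rel: "\<And>i. i < D \<Longrightarrow> lin_comb \<phi> ps i = lin_comb \<phi> qs i" and i: "i < D"
  shows "lin_comb \<psi> ps i = lin_comb \<psi> qs i"
proof -
  define d where "d f i = lin_comb f ps i - lin_comb f qs i" for f :: "'a \<Rightarrow> nat \<Rightarrow> complex" and i
  have expand: "(\<Sum>i<D. cnj (d f i) * d f i) =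
      (\<Sum>i<D. cnj (lin_comb f ps i) * lin_comb f ps i) - (\<Sum>i<D. cnj (lin_comb f ps i) * lin_comb f qs i)
    - (\<Sum>i<D. cnj (lin_comb f qs i) * lin_comb f ps i) + (\<Sum>i<D. cnj (lin_comb f qs i) * lin_comb f qs i)" for f
    by (simp add: d_def algebra_simps sum.distrib sum_subtractf)
  have "(\<Sum>i<D. cnj (d \<psi> i) * d \<psi> i) = (\<Sum>i<D. cnj (d \<phi> i) * d \<phi> i)"
    unfolding expand using gram_lin_comb[OF gram X(1) X(1)] gram_lin_comb[OF gram X(1) X(2)]
      gram_lin_comb[OF gram X(2) X(1)] gram_lin_comb[OF gram X(2) X(2)] by simp
  also have "\<dots> = 0" using rel by (intro sum.neutral) (auto simp: d_def)
  also have "(\<Sum>i<D. cnj (d \<psi> i) * d \<psi> i) = of_real (\<Sum>i<D. (cmod (d \<psi> i))\<^sup>2)"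
    unfolding of_real_sum by (intro sum.cong refl) (metis complex_norm_square mult.commute)
  finally have "(\<Sum>i<D. (cmod (d \<psi> i))\<^sup>2) = 0" using of_real_eq_0_iff by blast
  then have "\<forall>i<D. (cmod (d \<psi> i))\<^sup>2 = 0" by (subst (asm) sum_nonneg_eq_0_iff) auto
  then show ?thesis using i by (simp add: d_def)
qed

lemma subspace_lin_combs:
  "VectorSpace.subspace class_ring
     {w \<in> carrier_vec D. \<exists>ps. snd ` set ps \<subseteq> X \<and> (\<forall>i<D. vec_index w i = lin_comb \<phi> ps i)}
     (module_vec TYPE(complex) D)" (is "VectorSpace.subspace _ ?W _")
  unfolding subspace_module_vec_iff
proof (intro conjI ballI allI)
  show "?W \<subseteq> carrier_vec D" by blast
  have "\<exists>ps. snd ` set ps \<subseteq> X \<and> (\<forall>i<D. vec_index (0\<^sub>v D) i = lin_comb \<phi> ps i)"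
    by (rule exI[of _ "[]"]) simp
  then show "0\<^sub>v D \<in> ?W" by simp
next
  fix u v assume uv: "u \<in> ?W" "v \<in> ?W"
  then obtain ps qs where "snd ` set ps \<subseteq> X" "snd ` set qs \<subseteq> X"
    "\<forall>i<D. vec_index u i = lin_comb \<phi> ps i" "\<forall>i<D. vec_index v i = lin_comb \<phi> qs i" by blast
  then have "snd ` set (ps @ qs) \<subseteq> X" "\<forall>i<D. vec_index (u + v) i = lin_comb \<phi> (ps @ qs) i"
    using uv by auto
  then show "u + v \<in> ?W" using uv by (intro CollectI conjI exI[of _ "ps @ qs"]) auto
next
  fix c v assume v: "v \<in> ?W"
  then obtain ps where ps: "snd ` set ps \<subseteq> X" "\<forall>i<D. vec_index v i = lin_comb \<phi> ps i" by blast
  define qs where "qs = map (\<lambda>(d, x). (c * d, x)) ps"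
  have "snd ` set qs \<subseteq> X" using ps(1) unfolding qs_def by fastforce
  moreover have "\<forall>i<D. vec_index (c \<cdot>\<^sub>v v) i = lin_comb \<phi> qs i"
    using v ps(2) by (auto simp: qs_def lin_comb_scale)
  ultimately show "c \<cdot>\<^sub>v v \<in> ?W" using v by (intro CollectI conjI exI[of _ qs]) auto
qed

text \<open>
A group acting on a set \<open>X\<close> and preserving the Gram kernel of \<open>\<phi> : X \<rightarrow> \<complex>\<^sup>D\<close> acts unitarily on the span of
\<open>\<phi>(X)\<close>: by \<open>lin_comb_relation_transfer\<close> the map \<open>\<phi>(x) \<mapsto> \<phi>(g x)\<close> respects linear relations.

In matrices, \<open>P\<close> is an orthonormal basis of the span with columns written as combinations \<open>ps b\<close> of
the vectors \<open>\<phi>(x)\<close>, and \<open>R g\<close> is obtained by moving the points in these combinations by \<open>g\<close>. Then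
\<open>R g = P \<pi>(g)\<close> for the wanted representation \<open>\<pi>\<close>. The combinations do not depend on \<open>g\<close>; this is what makes
\<open>\<pi>\<close> continuous, and what makes its image finite when \<open>\<phi>(X)\<close> is.
\<close>

lemma unitary_rep_on_span:
  fixes G :: "('a, 'b) monoid_scheme" and act :: "'a \<Rightarrow> 'x \<Rightarrow> 'x" and \<phi> :: "'x \<Rightarrow> nat \<Rightarrow> complex"
  assumes G: "Group.group G" and T: "topspace T = carrier G"
    and act_closed: "\<And>g x. g \<in> carrier G \<Longrightarrow> x \<in> X \<Longrightarrow> act g x \<in> X"
    and act_mult: "\<And>g h x. g \<in> carrier G \<Longrightarrow> h \<in> carrier G \<Longrightarrow> x \<in> X \<Longrightarrow>
        act (g \<otimes>\<^bsub>G\<^esub> h) x = act g (act h x)"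
    and gram: "\<And>g x y. g \<in> carrier G \<Longrightarrow> x \<in> X \<Longrightarrow> y \<in> X \<Longrightarrow>
        (\<Sum>i<D. cnj (\<phi> x i) * \<phi> y i) = (\<Sum>i<D. cnj (\<phi> (act g x) i) * \<phi> (act g y) i)"
    and cont: "\<And>x i. x \<in> X \<Longrightarrow> i < D \<Longrightarrow> continuous_map T euclidean (\<lambda>g. \<phi> (act g x) i)"
  shows "\<exists>k \<pi>. unitary_rep G T k \<pi> \<and>
    (\<forall>g\<in>carrier G. \<forall>g'\<in>carrier G. \<forall>x\<in>X. \<forall>i<D. \<phi> (act g x) i \<noteq> \<phi> (act g' x) i \<longrightarrow> \<pi> g \<noteq> \<pi> g') \<and>
    (finite ((\<lambda>x. restrict (\<phi> x) {..<D}) ` X) \<longrightarrow> finite (\<pi> ` carrier G))"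
proof -
  interpret Group.group G by (rule G)
  define W where
    "W = {w \<in> carrier_vec D. \<exists>ps. snd ` set ps \<subseteq> X \<and> (\<forall>i<D. vec_index w i = lin_comb \<phi> ps i)}"
  obtain k P where P: "isometry_mat D k P" and PW: "\<And>u. u \<in> carrier_vec k \<Longrightarrow> P *\<^sub>v u \<in> W"
    and PP: "\<And>w. w \<in> W \<Longrightarrow> P *\<^sub>v (P\<^sup>H *\<^sub>v w) = w"
    using isometry_onto_subspace[OF subspace_lin_combs[where D = D and X = X and \<phi> = \<phi>]]
    unfolding W_def by blast
  note Pc = isometry_mat_carrier[OF P]
  have "\<exists>ps. snd ` set ps \<subseteq> X \<and> (\<forall>i<D. P $$ (i, b) = lin_comb \<phi> ps i)" if b: "b < k" for b
  proof -
    have "P *\<^sub>v unit_vec k b = col P b" using Pc b by (intro eq_vecI) (auto simp: scalar_prod_right_unit)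
    then have "col P b \<in> W" using PW[of "unit_vec k b"] by simp
    then show ?thesis unfolding W_def using Pc b by auto
  qed
  then obtain ps where psX: "\<And>b. b < k \<Longrightarrow> snd ` set (ps b) \<subseteq> X"
    and ps: "\<And>b i. b < k \<Longrightarrow> i < D \<Longrightarrow> P $$ (i, b) = lin_comb \<phi> (ps b) i" by metis
  define R where "R g = mat D k (\<lambda>(i, b). lin_comb (\<lambda>x. \<phi> (act g x)) (ps b) i)" for g
  have Rc: "R g \<in> carrier_mat D k" for g by (simp add: R_def)
  define \<pi> where "\<pi> g = P\<^sup>H * R g" for g
  have \<pi>c: "\<pi> g \<in> carrier_mat k k" for g unfolding \<pi>_def by (rule mult_carrier_mat[OF adj_carrier[OF Pc] Rc])
  have actX: "snd ` set (map (\<lambda>(c, x). (c, act g x)) qs) \<subseteq> X" if "g \<in> carrier G" "snd ` set qs \<subseteq> X" for g qs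
    using that act_closed by fastforce

  \<comment> \<open>\<open>R g\<close> applied to the coordinates of any combination of the \<open>\<phi>(x)\<close> moves its points by \<open>g\<close>.\<close>
  have R_relation: "vec_index (R g *\<^sub>v y) i = lin_comb (\<lambda>x. \<phi> (act g x)) qs i"
    if g: "g \<in> carrier G" and y: "y \<in> carrier_vec k" and qs: "snd ` set qs \<subseteq> X"
      and rel: "\<And>i. i < D \<Longrightarrow> vec_index (P *\<^sub>v y) i = lin_comb \<phi> qs i" and i: "i < D" for g y qs i
  proof -
    define L where "L = concat (map (\<lambda>b. map (\<lambda>(c, x). (vec_index y b * c, x)) (ps b)) [0..<k])"
    have LX: "snd ` set L \<subseteq> X" unfolding L_def using psX by fastforce
    have L: "lin_comb f L i = (\<Sum>b<k. lin_comb f (ps b) i * vec_index y b)" for f i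
      unfolding L_def lin_comb_concat lin_comb_scale by (simp add: mult.commute)
    have "lin_comb \<phi> L j = lin_comb \<phi> qs j" if j: "j < D" for j
    proof -
      have "vec_index (P *\<^sub>v y) j = (\<Sum>b<k. P $$ (j, b) * vec_index y b)"
        using Pc y j by (auto simp: scalar_prod_def lessThan_atLeast0)
      also have "\<dots> = lin_comb \<phi> L j" unfolding L using ps j by (intro sum.cong) auto
      finally show ?thesis using rel[OF j] by simp
    qed
    then have "lin_comb (\<lambda>x. \<phi> (act g x)) L i = lin_comb (\<lambda>x. \<phi> (act g x)) qs i"
      using lin_comb_relation_transfer[where \<phi> = \<phi> and \<psi> = "\<lambda>x. \<phi> (act g x)", OF gram[OF g] LX qs] i by blast
    moreover have "vec_index (R g *\<^sub>v y) i = lin_comb (\<lambda>x. \<phi> (act g x)) L i"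
      unfolding L using y i by (auto simp: R_def scalar_prod_def lessThan_atLeast0)
    ultimately show ?thesis by simp
  qed

  have R_iso: "isometry_mat D k (R g)" if g: "g \<in> carrier G" for g
  proof -
    have "(R g)\<^sup>H * R g = P\<^sup>H * P"
    proof (rule eq_matI)
      fix a b assume "a < dim_row (P\<^sup>H * P)" "b < dim_col (P\<^sup>H * P)"
      then have ab: "a < k" "b < k" using Pc by auto
      have "((R g)\<^sup>H * R g) $$ (a, b) = (\<Sum>i<D. cnj (lin_comb (\<lambda>x. \<phi> (act g x)) (ps a) i)
          * lin_comb (\<lambda>x. \<phi> (act g x)) (ps b) i)"
        unfolding adj_mult_index[OF Rc Rc ab] by (rule sum.cong) (use ab in \<open>auto simp: R_def\<close>)
      also have "\<dots> = (\<Sum>i<D. cnj (lin_comb \<phi> (ps a) i) * lin_comb \<phi> (ps b) i)"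
        using gram_lin_comb[where \<phi> = \<phi> and \<psi> = "\<lambda>x. \<phi> (act g x)", OF gram[OF g] psX[OF ab(1)] psX[OF ab(2)]] by simp
      also have "\<dots> = (P\<^sup>H * P) $$ (a, b)"
        unfolding adj_mult_index[OF Pc Pc ab] by (rule sum.cong) (use ab ps in auto)
      finally show "((R g)\<^sup>H * R g) $$ (a, b) = (P\<^sup>H * P) $$ (a, b)" .
    qed (use Rc[of g] Pc in auto)
    then show ?thesis using P Rc by (simp add: isometry_mat_def)
  qed

  have P\<pi>: "P * \<pi> g = R g" if g: "g \<in> carrier G" for g
  proof (rule mat_col_eqI)
    fix b assume "b < dim_col (R g)"
    then have b: "b < k" using Rc[of g] by simp
    have "col (R g) b \<in> W"
      unfolding W_def
    proof (intro CollectI conjI exI)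
      show "snd ` set (map (\<lambda>(c, x). (c, act g x)) (ps b)) \<subseteq> X" by (rule actX[OF g psX[OF b]])
      show "\<forall>i<D. vec_index (col (R g) b) i = lin_comb \<phi> (map (\<lambda>(c, x). (c, act g x)) (ps b)) i"
        unfolding lin_comb_map using b by (auto simp: R_def)
    qed (use Rc[of g] in auto)
    then have "P *\<^sub>v (P\<^sup>H *\<^sub>v col (R g) b) = col (R g) b" by (rule PP)
    then show "col (P * \<pi> g) b = col (R g) b"
      using col_mult2[OF Pc \<pi>c b] col_mult2[OF adj_carrier[OF Pc] Rc b] by (simp add: \<pi>_def)
  qed (use Pc \<pi>c[of g] Rc[of g] in auto)

  have R_mult: "R (g \<otimes>\<^bsub>G\<^esub> h) = R g * \<pi> h" if g: "g \<in> carrier G" and h: "h \<in> carrier G" for g h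
  proof (rule mat_col_eqI)
    fix b assume "b < dim_col (R g * \<pi> h)"
    then have b: "b < k" using \<pi>c[of h] by simp
    have c: "col (\<pi> h) b \<in> carrier_vec k" using \<pi>c[of h] by auto
    show "col (R (g \<otimes>\<^bsub>G\<^esub> h)) b = col (R g * \<pi> h) b"
    proof (rule eq_vecI)
      fix i assume "i < dim_vec (col (R g * \<pi> h) b)"
      then have i: "i < D" using Rc[of g] by simp
      have "vec_index (R g *\<^sub>v col (\<pi> h) b) i
          = lin_comb (\<lambda>x. \<phi> (act g x)) (map (\<lambda>(c, x). (c, act h x)) (ps b)) i"
      proof (rule R_relation[OF g c actX[OF h psX[OF b]] _ i])
        fix j assume j: "j < D"
        have "P *\<^sub>v col (\<pi> h) b = col (R h) b"
          using col_mult2[OF Pc \<pi>c[of h] b] P\<pi>[OF h] by simp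
        then show "vec_index (P *\<^sub>v col (\<pi> h) b) j = lin_comb \<phi> (map (\<lambda>(c, x). (c, act h x)) (ps b)) j"
          unfolding lin_comb_map using b j by (simp add: R_def)
      qed
      also have "\<dots> = lin_comb (\<lambda>x. \<phi> (act (g \<otimes>\<^bsub>G\<^esub> h) x)) (ps b) i"
        unfolding lin_comb_map
      proof (rule lin_comb_cong)
        fix c x assume "(c, x) \<in> set (ps b)"
        then have "x \<in> X" using psX[OF b] by force
        then show "\<phi> (act g (act h x)) i = \<phi> (act (g \<otimes>\<^bsub>G\<^esub> h) x) i" by (simp add: act_mult[OF g h])
      qed
      also have "\<dots> = vec_index (col (R (g \<otimes>\<^bsub>G\<^esub> h)) b) i" using i b by (simp add: R_def)
      finally show "vec_index (col (R (g \<otimes>\<^bsub>G\<^esub> h)) b) i = vec_index (col (R g * \<pi> h) b) i"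
        using col_mult2[OF Rc \<pi>c b] by simp
    qed (simp add: R_def)
  qed (use Rc[of g] Rc[of "g \<otimes>\<^bsub>G\<^esub> h"] \<pi>c[of h] in auto)

  have rep: "unitary_rep G T k \<pi>"
    unfolding unitary_rep_def
  proof (intro conjI ballI allI impI)
    fix g assume g: "g \<in> carrier G"
    have "isometry_mat D k (P * \<pi> g)" using R_iso[OF g] P\<pi>[OF g] by simp
    then show "unitary_mat k (\<pi> g)"
      by (intro isometry_mat_square isometry_mat_right_factor[OF P \<pi>c])
    fix h assume h: "h \<in> carrier G"
    show "\<pi> (g \<otimes>\<^bsub>G\<^esub> h) = \<pi> g * \<pi> h"
      using R_mult[OF g h] assoc_mult_mat[OF adj_carrier[OF Pc] Rc \<pi>c] by (simp add: \<pi>_def)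
  next
    fix a b assume ab: "a < k" "b < k"
    have "continuous_map T euclidean
        (\<lambda>g. \<Sum>i<D. cnj (P $$ (i, a)) * lin_comb (\<lambda>x. \<phi> (act g x)) (ps b) i)"
    proof (intro continuous_map_sum_complex continuous_map_mult_complex)
      fix i assume i: "i \<in> {..<D}"
      show "continuous_map T euclidean (\<lambda>g. lin_comb (\<lambda>x. \<phi> (act g x)) (ps b) i)"
      proof (rule continuous_map_lin_comb)
        fix c x assume "(c, x) \<in> set (ps b)"
        then have "x \<in> X" using psX[OF ab(2)] by force
        then show "continuous_map T euclidean (\<lambda>g. \<phi> (act g x) i)" using i by (simp add: cont)
      qed
    qed simp
    moreover have "\<pi> g $$ (a, b) = (\<Sum>i<D. cnj (P $$ (i, a)) * lin_comb (\<lambda>x. \<phi> (act g x)) (ps b) i)" for g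
      unfolding \<pi>_def adj_mult_index[OF Pc Rc ab] by (rule sum.cong) (use ab in \<open>auto simp: R_def\<close>)
    ultimately show "continuous_map T euclidean (\<lambda>g. \<pi> g $$ (a, b))" by simp
  qed

  have sep: "\<phi> (act g x) i = \<phi> (act g' x) i"
    if g: "g \<in> carrier G" "g' \<in> carrier G" and x: "x \<in> X" and i: "i < D" and eq: "\<pi> g = \<pi> g'" for g g' x i
  proof -
    have v: "vec D (\<phi> x) \<in> W"
      unfolding W_def using x by (auto intro!: exI[of _ "[(1, x)]"])
    have y: "P\<^sup>H *\<^sub>v vec D (\<phi> x) \<in> carrier_vec k"
      using mult_mat_vec_carrier[OF adj_carrier[OF Pc]] by simp
    have "vec_index (R h *\<^sub>v (P\<^sup>H *\<^sub>v vec D (\<phi> x))) i = \<phi> (act h x) i" if h: "h \<in> carrier G" for h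
      using R_relation[OF h y, of "[(1, x)]" i] x i PP[OF v] by simp
    from this[OF g(1)] this[OF g(2)] show ?thesis
      using P\<pi>[OF g(1)] P\<pi>[OF g(2)] eq by simp
  qed

  have fin: "finite (\<pi> ` carrier G)" if S: "finite ((\<lambda>x. restrict (\<phi> x) {..<D}) ` X)"
  proof -
    define Y where "Y = (\<Union>b<k. snd ` set (ps b))"
    \<comment> \<open>\<open>\<pi> g\<close> depends only on where \<open>g\<close> sends the finitely many points occurring in the combinations.\<close>
    define key where "key g = (\<lambda>x\<in>Y. restrict (\<phi> (act g x)) {..<D})" for g
    have Y: "finite Y" "Y \<subseteq> X" unfolding Y_def using psX by auto
    have "key ` carrier G \<subseteq> Y \<rightarrow>\<^sub>E (\<lambda>x. restrict (\<phi> x) {..<D}) ` X"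
    proof (intro image_subsetI PiE_I)
      fix g x assume "g \<in> carrier G" "x \<in> Y"
      then show "key g x \<in> (\<lambda>x. restrict (\<phi> x) {..<D}) ` X"
        using Y(2) act_closed[of g x] by (auto simp: key_def)
    qed (simp add: key_def)
    then have "finite (key ` carrier G)" by (rule finite_subset) (intro finite_PiE Y(1) S)
    moreover have det: "\<pi> g = \<pi> g'" if "key g = key g'" for g g'
    proof -
      have *: "\<phi> (act g x) i = \<phi> (act g' x) i" if "x \<in> Y" "i < D" for x i
        using fun_cong[OF fun_cong[OF \<open>key g = key g'\<close>, of x], of i] that by (simp add: key_def)
      have "lin_comb (\<lambda>x. \<phi> (act g x)) (ps b) i = lin_comb (\<lambda>x. \<phi> (act g' x)) (ps b) i"
        if "b < k" "i < D" for b i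
      proof (rule lin_comb_cong)
        fix c x assume "(c, x) \<in> set (ps b)"
        then have "x \<in> Y" using \<open>b < k\<close> unfolding Y_def by force
        then show "\<phi> (act g x) i = \<phi> (act g' x) i" using \<open>i < D\<close> by (rule *)
      qed
      then have "R g = R g'" unfolding R_def by (intro cong_mat) auto
      then show ?thesis by (simp add: \<pi>_def)
    qed
    have "\<pi> g = \<pi> (SOME g'. key g' = key g)" for g
      by (rule det, rule sym, rule someI, rule refl)
    then have "\<pi> ` carrier G = (\<lambda>z. \<pi> (SOME g'. key g' = z)) ` (key ` carrier G)"
      unfolding image_image by (intro image_cong refl)
    ultimately show ?thesis by (simp only: finite_imageI)
  qed
  show ?thesis
  proof (intro exI conjI ballI allI impI)
    show "unitary_rep G T k \<pi>" by (rule rep)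
    show "finite (\<pi> ` carrier G)" if "finite ((\<lambda>x. restrict (\<phi> x) {..<D}) ` X)" using that by (rule fin)
    fix g g' x i
    assume "g \<in> carrier G" "g' \<in> carrier G" "x \<in> X" "i < D" "\<phi> (act g x) i \<noteq> \<phi> (act g' x) i"
    with sep[of g g' x i] show "\<pi> g \<noteq> \<pi> g'" by blast
  qed
qed

section \<open>The finite dimensional dual and separation of points\<close>

text \<open>
The flag allows one proof for both dual spaces: \<open>False\<close> gives \<open>fd_dual\<close> and \<open>True\<close> gives
\<open>finite_dual\<close>.
\<close>

definition image_restricted_dual :: "bool \<Rightarrow> ('a, 'b) monoid_scheme \<Rightarrow> 'a topology \<Rightarrow> 'a rep set set" where
  "image_restricted_dual fin G T =
     {C \<in> fd_dual G T. fin \<longrightarrow> (\<forall>(n, \<pi>)\<in>C. finite (\<pi> ` carrier G))}"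

definition image_restricted_dual_per ::
    "bool \<Rightarrow> ('a, 'b) monoid_scheme \<Rightarrow> 'a topology \<Rightarrow> 'a set \<Rightarrow> 'a set \<Rightarrow> 'a rep set set" where
  "image_restricted_dual_per fin G T N H =
     {C \<in> image_restricted_dual fin (subgroup_of G N) (subtopology T N). finite (dual_orbit G T N H C)}"

lemma image_restricted_dual_simps:
  "image_restricted_dual False G T = fd_dual G T" "image_restricted_dual True G T = finite_dual G T"
  by (simp_all add: image_restricted_dual_def finite_dual_def)

lemma image_restricted_dual_per_simps:
  "image_restricted_dual_per False G T N H = fd_dual_per G T N H"
  "image_restricted_dual_per True G T N H = finite_dual_per G T N H"
  unfolding image_restricted_dual_per_def fd_dual_per_def finite_dual_per_def image_restricted_dual_simps
  by (rule refl)+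

lemma unitary_equivalence_finite_image:
  assumes "((n, \<pi>), (m, \<rho>)) \<in> unitary_equivalence G T" and "finite (\<pi> ` carrier G)"
  shows "finite (\<rho> ` carrier G)"
proof -
  obtain U where "\<And>g. g \<in> carrier G \<Longrightarrow> \<rho> g = U * \<pi> g * U\<^sup>H"
    using assms(1) by (rule unitary_equivalenceE) blast
  then have "\<rho> ` carrier G = (\<lambda>A. U * A * U\<^sup>H) ` \<pi> ` carrier G" unfolding image_image by (intro image_cong refl)
  then show ?thesis using assms(2) by (simp only: finite_imageI)
qed

lemma class_mem_fd_dual:
  "(n, \<pi>) \<in> fd_irreps G T \<Longrightarrow> unitary_equivalence G T `` {(n, \<pi>)} \<in> fd_dual G T"
  by (simp add: fd_dual_def quotientI)

lemma mem_own_class: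
  "(n, \<pi>) \<in> fd_irreps G T \<Longrightarrow> (n, \<pi>) \<in> unitary_equivalence G T `` {(n, \<pi>)}"
  by (rule equiv_class_self[OF equiv_unitary_equivalence])

lemma fd_dual_class_of_mem:
  assumes "C \<in> fd_dual G T" "p \<in> C"
  shows "p \<in> fd_irreps G T" "C = unitary_equivalence G T `` {p}"
proof -
  show p: "p \<in> fd_irreps G T"
    using assms in_quotient_imp_subset[OF equiv_unitary_equivalence] unfolding fd_dual_def by blast
  obtain q where "C = unitary_equivalence G T `` {q}" using assms(1) unfolding fd_dual_def by (rule quotientE)
  then show "C = unitary_equivalence G T `` {p}"
    using assms(2) equiv_class_eq[OF equiv_unitary_equivalence, of q p] by simp
qed

lemma class_mem_image_restricted_dual:
  assumes "(n, \<pi>) \<in> fd_irreps G T" and "fin \<longrightarrow> finite (\<pi> ` carrier G)"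
  shows "unitary_equivalence G T `` {(n, \<pi>)} \<in> image_restricted_dual fin G T"
  using class_mem_fd_dual[OF assms(1)] assms(2) unitary_equivalence_finite_image[of n \<pi> _ _ G T]
  by (auto simp: image_restricted_dual_def)

lemma separates_pointsI:
  assumes "\<And>g g'. g \<in> carrier G \<Longrightarrow> g' \<in> carrier G \<Longrightarrow> g \<noteq> g' \<Longrightarrow>
     \<exists>n \<pi>. (n, \<pi>) \<in> fd_irreps G T \<and> unitary_equivalence G T `` {(n, \<pi>)} \<in> S \<and> \<pi> g \<noteq> \<pi> g'"
  shows "separates_points G S"
  unfolding separates_points_def
proof (intro ballI impI)
  fix g g' assume "g \<in> carrier G" "g' \<in> carrier G" "g \<noteq> g'"
  then obtain n \<pi> where *: "(n, \<pi>) \<in> fd_irreps G T" "unitary_equivalence G T `` {(n, \<pi>)} \<in> S" "\<pi> g \<noteq> \<pi> g'"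
    using assms by blast
  show "\<exists>C\<in>S. \<exists>(n, \<pi>)\<in>C. \<pi> g \<noteq> \<pi> g'"
    using *(2,3) mem_own_class[OF *(1)] by blast
qed

lemma separates_pointsE:
  assumes "separates_points G S" "S \<subseteq> image_restricted_dual fin G T"
    and "g \<in> carrier G" "g' \<in> carrier G" "g \<noteq> g'"
  obtains n \<pi> where "(n, \<pi>) \<in> fd_irreps G T" "fin \<longrightarrow> finite (\<pi> ` carrier G)"
    "unitary_equivalence G T `` {(n, \<pi>)} \<in> S" "\<pi> g \<noteq> \<pi> g'"
proof -
  obtain C n \<pi> where C: "C \<in> S" "(n, \<pi>) \<in> C" "\<pi> g \<noteq> \<pi> g'"
    using assms unfolding separates_points_def by blast
  then have "C \<in> image_restricted_dual fin G T" using assms(2) by blast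
  then have "C \<in> fd_dual G T" "fin \<longrightarrow> finite (\<pi> ` carrier G)"
    using C(2) by (auto simp: image_restricted_dual_def)
  with fd_dual_class_of_mem[OF this(1) C(2)] C that show thesis by blast
qed

lemma exists_separating_irrep:
  assumes G: "Group.group G" and T: "topspace T = carrier G" and \<pi>: "unitary_rep G T n \<pi>"
    and g: "g \<in> carrier G" "g' \<in> carrier G" "\<pi> g \<noteq> \<pi> g'" and fin: "fin \<longrightarrow> finite (\<pi> ` carrier G)"
  obtains k \<sigma> P where "(k, \<sigma>) \<in> fd_irreps G T" "embeds_via G k \<sigma> n \<pi> P" "\<sigma> g \<noteq> \<sigma> g'"
    "fin \<longrightarrow> finite (\<sigma> ` carrier G)"
proof -
  obtain k \<sigma> P where *: "(k, \<sigma>) \<in> fd_irreps G T" "embeds_via G k \<sigma> n \<pi> P" "\<sigma> g \<noteq> \<sigma> g'"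
    using exists_separating_irreducible_subrep[OF G T g(1,2) \<pi> g(3)] by blast
  have "\<sigma> ` carrier G = (\<lambda>A. P\<^sup>H * (A * P)) ` \<pi> ` carrier G"
    unfolding image_image using embeds_viaD(5)[OF *(2)] by (intro image_cong refl)
  then have "fin \<longrightarrow> finite (\<sigma> ` carrier G)" using fin by auto
  with * show thesis by (rule that)
qed

lemma unitary_rep_restrict:
  assumes "unitary_rep G T n \<pi>" "S \<subseteq> carrier G"
  shows "unitary_rep (subgroup_of G S) (subtopology T S) n \<pi>"
  using assms by (auto simp: unitary_rep_def subset_iff continuous_map_from_subtopology)

section \<open>Characters\<close>

lemma trace_mult_commute:
  fixes A B :: "complex mat"
  assumes "A \<in> carrier_mat n m" "B \<in> carrier_mat m n"
  shows "(\<Sum>a<n. (A * B) $$ (a, a)) = (\<Sum>b<m. (B * A) $$ (b, b))"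
proof -
  have "(\<Sum>a<n. (A * B) $$ (a, a)) = (\<Sum>a<n. \<Sum>b<m. A $$ (a, b) * B $$ (b, a))"
    using assms by (intro sum.cong) (auto simp: scalar_prod_def lessThan_atLeast0)
  also have "\<dots> = (\<Sum>b<m. \<Sum>a<n. B $$ (b, a) * A $$ (a, b))"
    by (subst sum.swap) (simp add: mult.commute)
  also have "\<dots> = (\<Sum>b<m. (B * A) $$ (b, b))"
    using assms by (intro sum.cong) (auto simp: scalar_prod_def lessThan_atLeast0)
  finally show ?thesis .
qed

definition rep_character :: "nat \<Rightarrow> ('a \<Rightarrow> complex mat) \<Rightarrow> 'a \<Rightarrow> complex" where
  "rep_character n \<sigma> g = (\<Sum>a<n. \<sigma> g $$ (a, a))"

lemma rep_character_equivalent: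
  assumes "((n, \<sigma>), (n, \<tau>)) \<in> unitary_equivalence G T" and g: "g \<in> carrier G"
  shows "rep_character n \<tau> g = rep_character n \<sigma> g"
proof -
  obtain U where \<sigma>: "(n, \<sigma>) \<in> fd_irreps G T" and U: "unitary_mat n U" and \<tau>: "\<tau> g = U * \<sigma> g * U\<^sup>H"
    using assms by (elim unitary_equivalenceE) auto
  note Uc = unitary_mat_carrier[OF U] and \<sigma>c = fd_irreps_carrier[OF \<sigma> g]
  have "\<tau> g = U * (\<sigma> g * U\<^sup>H)" unfolding \<tau> by (rule assoc_mult_mat[OF Uc \<sigma>c adj_carrier[OF Uc]])
  then have "rep_character n \<tau> g = (\<Sum>a<n. (\<sigma> g * U\<^sup>H * U) $$ (a, a))"
    unfolding rep_character_def
    using trace_mult_commute[OF Uc mult_carrier_mat[OF \<sigma>c adj_carrier[OF Uc]]] by simp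
  also have "\<sigma> g * U\<^sup>H * U = \<sigma> g"
    using assoc_mult_mat[OF \<sigma>c adj_carrier[OF Uc] Uc] U right_mult_one_mat[OF \<sigma>c]
    by (simp add: unitary_mat_def)
  finally show ?thesis by (simp add: rep_character_def)
qed

text \<open>
The Hilbert-Schmidt inner product of \<open>\<rho>(x)\<close> and \<open>\<rho>(y)\<close> is the trace of \<open>\<rho>(x)\<^sup>H \<rho>(y) = \<rho>(x\<inverse> y)\<close>. The element
\<open>z = x\<inverse> y\<close> enters only through \<open>\<rho>(x) \<rho>(z) = \<rho>(y)\<close>.
\<close>

lemma inner_eq_rep_character:
  assumes x: "unitary_mat n (\<rho> x)" and xy: "\<rho> x * \<rho> z = \<rho> y" and z: "\<rho> z \<in> carrier_mat n n"
  shows "(\<Sum>a<n. \<Sum>b<n. cnj (\<rho> x $$ (a, b)) * \<rho> y $$ (a, b)) = rep_character n \<rho> z"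
proof -
  note xc = unitary_mat_carrier[OF x]
  have "\<rho> z = (\<rho> x)\<^sup>H * \<rho> y"
    using isometry_mat_cancel[OF unitary_mat_isometry[OF x] z] xy by simp
  moreover have yc: "\<rho> y \<in> carrier_mat n n" using xy mult_carrier_mat[OF xc z] by simp
  ultimately have "rep_character n \<rho> z = (\<Sum>b<n. \<Sum>a<n. cnj (\<rho> x $$ (a, b)) * \<rho> y $$ (a, b))"
    unfolding rep_character_def by (intro sum.cong refl) (simp only: adj_mult_index[OF xc yc] lessThan_iff)
  also have "\<dots> = (\<Sum>a<n. \<Sum>b<n. cnj (\<rho> x $$ (a, b)) * \<rho> y $$ (a, b))" by (rule sum.swap)
  finally show ?thesis by simp
qed

section \<open>Semi-direct products\<close>

locale semidirect_top_group =
  fixes G :: "('a, 'b) monoid_scheme" (structure) and T :: "'a topology" and N H :: "'a set"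
  assumes TG: "topological_group G T" and SD: "topological_semidirect_product G T N H"
begin

sublocale Group.group G using TG by (simp add: topological_group_def)

lemma topT: "topspace T = carrier G" using TG by (simp add: topological_group_def)

lemma normal_N: "N \<lhd> G" and subgroup_H: "subgroup H G"
  using SD by (auto simp: topological_semidirect_product_def)

sublocale normal N G by (rule normal_N)

lemma N_carrier: "x \<in> N \<Longrightarrow> x \<in> carrier G" using subset by blast
lemma H_carrier: "h \<in> H \<Longrightarrow> h \<in> carrier G" using subgroup.subset[OF subgroup_H] by blast

lemma topN: "topspace (subtopology T N) = carrier (subgroup_of G N)"
  and topH: "topspace (subtopology T H) = carrier (subgroup_of G H)"
  using N_carrier H_carrier by (auto simp: topT)

lemma group_N: "Group.group (subgroup_of G N)" and group_H: "Group.group (subgroup_of G H)"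
  using subgroup_imp_group[OF subgroup_axioms] subgroup_imp_group[OF subgroup_H] by auto

lemma continuous_map_mult:
  assumes "continuous_map X T f" "continuous_map X T g"
  shows "continuous_map X T (\<lambda>x. f x \<otimes> g x)"
proof -
  have "continuous_map (prod_topology T T) T (\<lambda>(x, y). x \<otimes> y)"
    using TG by (simp add: topological_group_def)
  from continuous_map_compose[OF continuous_map_pairedI[OF assms] this] show ?thesis by (simp add: o_def)
qed

lemma continuous_map_inv:
  assumes "continuous_map X T f"
  shows "continuous_map X T (\<lambda>x. inv (f x))"
proof -
  have "continuous_map T T (\<lambda>x. inv x)" using TG by (simp add: topological_group_def)
  from continuous_map_compose[OF assms this] show ?thesis by (simp add: o_def)
qed

text \<open>
The projection of \<open>G = N \<rtimes> H\<close> onto \<open>H\<close> with kernel \<open>N\<close>. It is continuous because multiplication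
\<open>N \<times> H \<rightarrow> G\<close> is a homeomorphism.
\<close>

definition H_part :: "'a \<Rightarrow> 'a" where
  "H_part g = snd (inv_into (N \<times> H) (\<lambda>(x, h). x \<otimes> h) g)"

lemma homeomorphism_inverse:
  obtains q where "continuous_map T (prod_topology (subtopology T N) (subtopology T H)) q"
    "\<And>x h. x \<in> N \<Longrightarrow> h \<in> H \<Longrightarrow> q (x \<otimes> h) = (x, h)"
proof -
  have "homeomorphic_map (prod_topology (subtopology T N) (subtopology T H)) T (\<lambda>(x, h). x \<otimes> h)"
    using SD by (simp add: topological_semidirect_product_def)
  then obtain q where q: "homeomorphic_maps (prod_topology (subtopology T N) (subtopology T H)) T
      (\<lambda>(x, h). x \<otimes> h) q"
    unfolding homeomorphic_map_maps by blast
  have "topspace (prod_topology (subtopology T N) (subtopology T H)) = N \<times> H"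
    using topN topH by simp
  then have "q (x \<otimes> h) = (x, h)" if "x \<in> N" "h \<in> H" for x h
    using q that unfolding homeomorphic_maps_def by auto
  moreover have "continuous_map T (prod_topology (subtopology T N) (subtopology T H)) q"
    using q by (simp add: homeomorphic_maps_def)
  ultimately show thesis using that by blast
qed

lemma H_part_mult_N_H:
  assumes "x \<in> N" "h \<in> H"
  shows "H_part (x \<otimes> h) = h"
proof -
  obtain q where q: "\<And>x h. x \<in> N \<Longrightarrow> h \<in> H \<Longrightarrow> q (x \<otimes> h) = (x, h)"
    using homeomorphism_inverse by metis
  have "inj_on (\<lambda>(x, h). x \<otimes> h) (N \<times> H)"
  proof (rule inj_onI)
    fix u v assume "u \<in> N \<times> H" "v \<in> N \<times> H" "(\<lambda>(x, h). x \<otimes> h) u = (\<lambda>(x, h). x \<otimes> h) v"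
    then show "u = v" using q[of "fst u" "snd u"] q[of "fst v" "snd v"] by auto
  qed
  from inv_into_f_f[OF this, of "(x, h)"] show ?thesis using assms by (simp add: H_part_def)
qed

lemma N_H_decomposition:
  assumes "g \<in> carrier G"
  obtains x h where "x \<in> N" "h \<in> H" "g = x \<otimes> h"
proof -
  have "g \<in> N <#> H" using SD assms by (simp add: topological_semidirect_product_def)
  then show thesis using that by (auto simp: set_mult_def)
qed

lemma H_part_in_H: "g \<in> carrier G \<Longrightarrow> H_part g \<in> H"
  by (elim N_H_decomposition) (simp add: H_part_mult_N_H)

lemma H_part_carrier: "g \<in> carrier G \<Longrightarrow> H_part g \<in> carrier G"
  by (rule H_carrier[OF H_part_in_H])

lemma H_part_of_N: "x \<in> N \<Longrightarrow> H_part x = \<one>"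
  using H_part_mult_N_H[OF _ subgroup.one_closed[OF subgroup_H]] N_carrier by fastforce

lemma H_part_of_H: "h \<in> H \<Longrightarrow> H_part h = h"
  using H_part_mult_N_H[OF one_closed] H_carrier by fastforce

lemma mult_inv_H_part_in_N:
  assumes "g \<in> carrier G"
  shows "g \<otimes> inv (H_part g) \<in> N"
proof -
  obtain x h where xh: "x \<in> N" "h \<in> H" "g = x \<otimes> h" using N_H_decomposition[OF assms] .
  then have "g \<otimes> inv (H_part g) = x" using N_carrier H_carrier by (simp add: H_part_mult_N_H m_assoc)
  then show ?thesis using xh by simp
qed

lemma H_part_mult:
  assumes "g \<in> carrier G" "g' \<in> carrier G"
  shows "H_part (g \<otimes> g') = H_part g \<otimes> H_part g'"
proof -
  obtain x h where xh: "x \<in> N" "h \<in> H" "g = x \<otimes> h" using N_H_decomposition[OF assms(1)] .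
  obtain x' h' where xh': "x' \<in> N" "h' \<in> H" "g' = x' \<otimes> h'" using N_H_decomposition[OF assms(2)] .
  have c: "x \<in> carrier G" "h \<in> carrier G" "x' \<in> carrier G" "h' \<in> carrier G"
    using xh xh' N_carrier H_carrier by auto
  have "inv h \<otimes> (h \<otimes> h') = h'" using c by (simp flip: m_assoc)
  then have "g \<otimes> g' = (x \<otimes> (h \<otimes> x' \<otimes> inv h)) \<otimes> (h \<otimes> h')" using c xh xh' by (simp add: m_assoc)
  moreover have "x \<otimes> (h \<otimes> x' \<otimes> inv h) \<in> N" using inv_op_closed2[OF c(2) xh'(1)] xh(1) by simp
  moreover have "h \<otimes> h' \<in> H" using xh xh' subgroup.m_closed[OF subgroup_H] by blast
  ultimately have "H_part (g \<otimes> g') = h \<otimes> h'" by (simp only: H_part_mult_N_H)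
  then show ?thesis using xh xh' by (simp add: H_part_mult_N_H)
qed

lemma continuous_map_H_part: "continuous_map T (subtopology T H) H_part"
proof -
  obtain q where q: "continuous_map T (prod_topology (subtopology T N) (subtopology T H)) q"
    "\<And>x h. x \<in> N \<Longrightarrow> h \<in> H \<Longrightarrow> q (x \<otimes> h) = (x, h)"
    using homeomorphism_inverse by blast
  show ?thesis
  proof (rule continuous_map_eq[OF continuous_map_compose[OF q(1) continuous_map_snd]])
    fix g assume "g \<in> topspace T"
    then obtain x h where "x \<in> N" "h \<in> H" "g = x \<otimes> h" using N_H_decomposition topT by metis
    then show "(snd \<circ> q) g = H_part g" by (simp add: q(2) H_part_mult_N_H)
  qed
qed

abbreviation "E \<equiv> unitary_equivalence (subgroup_of G N) (subtopology T N)"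

text \<open>
The representations \<open>(\<sigma>\<^sup>k)\<^sup>h\<close> and \<open>\<sigma>\<^bsup>hk\<^esup>\<close> agree on \<open>N\<close> but may differ, as functions, outside \<open>N\<close>, so
the two classes are compared by an equivalence with the identity matrix as intertwiner.
\<close>

lemma dual_action_comp:
  assumes C: "C \<in> fd_dual (subgroup_of G N) (subtopology T N)" and h: "h \<in> carrier G" "k \<in> carrier G"
  shows "dual_action G T N h (dual_action G T N k C) = dual_action G T N (h \<otimes> k) C"
proof -
  obtain p where p: "p \<in> fd_irreps (subgroup_of G N) (subtopology T N)" "C = E `` {p}"
    using C unfolding fd_dual_def by (rule quotientE)
  obtain n \<sigma> where np: "p = (n, \<sigma>)" by (cases p)
  note pk = conj_rep_fd_irreps[OF TG normal_N h(2) p(1)]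
  note phk = conj_rep_fd_irreps[OF TG normal_N h(1) pk]
  note phk' = conj_rep_fd_irreps[OF TG normal_N monoid.m_closed[OF is_monoid h] p(1)]
  have eq: "conj_rep G (h \<otimes> k) p = (n, \<lambda>x. \<sigma> (inv (h \<otimes> k) \<otimes> x \<otimes> (h \<otimes> k)))"
    "conj_rep G h (conj_rep G k p) = (n, \<lambda>x. \<sigma> (inv k \<otimes> (inv h \<otimes> x \<otimes> h) \<otimes> k))"
    by (simp_all add: np conj_rep_def)
  have "(conj_rep G h (conj_rep G k p), conj_rep G (h \<otimes> k) p) \<in> E"
    unfolding eq
  proof (rule unitary_equivalenceI[OF _ _ unitary_mat_one])
    show "(n, \<lambda>x. \<sigma> (inv k \<otimes> (inv h \<otimes> x \<otimes> h) \<otimes> k)) \<in> fd_irreps (subgroup_of G N) (subtopology T N)"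
      using phk by (simp only: eq)
    show *: "(n, \<lambda>x. \<sigma> (inv (h \<otimes> k) \<otimes> x \<otimes> (h \<otimes> k))) \<in> fd_irreps (subgroup_of G N) (subtopology T N)"
      using phk' by (simp only: eq)
    fix x assume x: "x \<in> carrier (subgroup_of G N)"
    then have xc: "x \<in> carrier G" using N_carrier by simp
    have "inv (h \<otimes> k) \<otimes> x \<otimes> (h \<otimes> k) = inv k \<otimes> (inv h \<otimes> x \<otimes> h) \<otimes> k"
      using h xc by (simp add: inv_mult_group m_assoc)
    then show "\<sigma> (inv (h \<otimes> k) \<otimes> x \<otimes> (h \<otimes> k)) = 1\<^sub>m n * \<sigma> (inv k \<otimes> (inv h \<otimes> x \<otimes> h) \<otimes> k) * (1\<^sub>m n)\<^sup>H"
      using fd_irreps_carrier[OF * x] by (simp add: left_mult_one_mat[of _ n n] right_mult_one_mat[of _ n n])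
  qed
  then show ?thesis
    unfolding p(2) dual_action_class[OF TG normal_N h(2) p(1)] dual_action_class[OF TG normal_N h(1) pk]
      dual_action_class[OF TG normal_N monoid.m_closed[OF is_monoid h] p(1)]
    by (rule equiv_class_eq[OF equiv_unitary_equivalence])
qed

lemma dual_action_one:
  assumes C: "C \<in> fd_dual (subgroup_of G N) (subtopology T N)"
  shows "dual_action G T N \<one> C = C"
proof -
  obtain p where p: "p \<in> fd_irreps (subgroup_of G N) (subtopology T N)" "C = E `` {p}"
    using C unfolding fd_dual_def by (rule quotientE)
  obtain n \<sigma> where np: "p = (n, \<sigma>)" by (cases p)
  have eq: "conj_rep G \<one> p = (n, \<lambda>x. \<sigma> (inv \<one> \<otimes> x \<otimes> \<one>))"
    by (simp only: np conj_rep_def prod.case)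
  have "(p, conj_rep G \<one> p) \<in> E"
    unfolding eq unfolding np
  proof (rule unitary_equivalenceI[OF _ _ unitary_mat_one])
    show *: "(n, \<sigma>) \<in> fd_irreps (subgroup_of G N) (subtopology T N)" using p(1) np by simp
    show "(n, \<lambda>x. \<sigma> (inv \<one> \<otimes> x \<otimes> \<one>)) \<in> fd_irreps (subgroup_of G N) (subtopology T N)"
      using conj_rep_fd_irreps[OF TG normal_N monoid.one_closed[OF is_monoid] p(1)]
      by (simp only: eq)
    fix x assume x: "x \<in> carrier (subgroup_of G N)"
    then have "inv \<one> \<otimes> x \<otimes> \<one> = x" using N_carrier by simp
    then show "\<sigma> (inv \<one> \<otimes> x \<otimes> \<one>) = 1\<^sub>m n * \<sigma> x * (1\<^sub>m n)\<^sup>H"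
      using fd_irreps_carrier[OF * x] by (simp add: left_mult_one_mat[of _ n n] right_mult_one_mat[of _ n n])
  qed
  then show ?thesis
    unfolding p(2) dual_action_class[OF TG normal_N monoid.one_closed[OF is_monoid] p(1)]
    by (rule equiv_class_eq[OF equiv_unitary_equivalence, symmetric])
qed

lemma dual_action_permutes_orbit:
  assumes C: "C \<in> fd_dual (subgroup_of G N) (subtopology T N)" and h: "h \<in> H"
  shows "bij_betw (dual_action G T N h) (dual_orbit G T N H C) (dual_orbit G T N H C)"
proof -
  have hi: "inv h \<in> H" using subgroup.m_inv_closed[OF subgroup_H h] .
  have mem: "D \<in> fd_dual (subgroup_of G N) (subtopology T N)" if "D \<in> dual_orbit G T N H C" for D
  proof -
    obtain k where k: "k \<in> H" "D = dual_action G T N k C" using \<open>D \<in> _\<close> by (auto simp: dual_orbit_def)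
    obtain p where p: "p \<in> fd_irreps (subgroup_of G N) (subtopology T N)" "C = E `` {p}"
      using C unfolding fd_dual_def by (rule quotientE)
    show ?thesis
      unfolding k(2) p(2) dual_action_class[OF TG normal_N H_carrier[OF k(1)] p(1)] fd_dual_def
      by (rule quotientI[OF conj_rep_fd_irreps[OF TG normal_N H_carrier[OF k(1)] p(1)]])
  qed
  have maps: "dual_action G T N k D \<in> dual_orbit G T N H C" if k: "k \<in> H" and D: "D \<in> dual_orbit G T N H C" for k D
  proof -
    obtain l where l: "l \<in> H" "D = dual_action G T N l C" using D by (auto simp: dual_orbit_def)
    have "dual_action G T N k D = dual_action G T N (k \<otimes> l) C"
      unfolding l(2) by (rule dual_action_comp[OF C H_carrier[OF k] H_carrier[OF l(1)]])
    then show ?thesis using subgroup.m_closed[OF subgroup_H k l(1)] by (auto simp: dual_orbit_def)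
  qed
  show ?thesis
  proof (rule bij_betw_byWitness[where f' = "dual_action G T N (inv h)"])
    show "\<forall>D\<in>dual_orbit G T N H C. dual_action G T N (inv h) (dual_action G T N h D) = D"
      using dual_action_comp[OF mem] dual_action_one[OF mem] H_carrier[OF h] by simp
    show "\<forall>D\<in>dual_orbit G T N H C. dual_action G T N h (dual_action G T N (inv h) D) = D"
      using dual_action_comp[OF mem] dual_action_one[OF mem] H_carrier[OF h] by simp
  qed (use maps h hi in auto)
qed

text \<open>
The representation of \<open>G\<close> on the span of \<open>\<rho>(N)\<close>, where \<open>\<rho>\<close> is the sum of the orbit of \<open>\<sigma>\<close>. The sum is not
formed as a block matrix: \<open>\<phi>(y)\<close> lists all matrix entries of all \<open>\<rho> D y\<close>, for \<open>D\<close> in the orbit. Its Gram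
kernel is \<open>F(y\<inverse> z)\<close> with \<open>F\<close> the sum of the characters, and \<open>F\<close> is invariant under conjugation by \<open>H\<close>
because \<open>H\<close> permutes the orbit and characters depend only on the class.
\<close>

lemma unitary_rep_extending_periodic:
  assumes \<sigma>: "(n, \<sigma>) \<in> fd_irreps (subgroup_of G N) (subtopology T N)"
    and per: "finite (dual_orbit G T N H (E `` {(n, \<sigma>)}))"
    and fin: "fin \<longrightarrow> finite (\<sigma> ` N)"
    and x: "x \<in> N" "x' \<in> N" "\<sigma> x \<noteq> \<sigma> x'" and h: "h \<in> H"
  obtains k \<pi> where "unitary_rep G T k \<pi>" "\<pi> (x \<otimes> h) \<noteq> \<pi> (x' \<otimes> h)" "fin \<longrightarrow> finite (\<pi> ` carrier G)"
proof -
  define C where "C = E `` {(n, \<sigma>)}"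
  define Orb where "Orb = dual_orbit G T N H C"
  have C: "C \<in> fd_dual (subgroup_of G N) (subtopology T N)" unfolding C_def by (rule class_mem_fd_dual[OF \<sigma>])
  have finO: "finite Orb" using per by (simp add: Orb_def C_def)

  have "\<forall>D\<in>Orb. \<exists>h. h \<in> H \<and> D = E `` {conj_rep G h (n, \<sigma>)}"
  proof
    fix D assume "D \<in> Orb"
    then obtain h where "h \<in> H" "D = dual_action G T N h C" by (auto simp: Orb_def dual_orbit_def)
    then show "\<exists>h. h \<in> H \<and> D = E `` {conj_rep G h (n, \<sigma>)}"
      using dual_action_class[OF TG normal_N H_carrier \<sigma>] by (auto simp: C_def)
  qed
  then obtain c where cH: "\<And>D. D \<in> Orb \<Longrightarrow> c D \<in> H"
    and cD: "\<And>D. D \<in> Orb \<Longrightarrow> D = E `` {conj_rep G (c D) (n, \<sigma>)}" by metis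
  define \<rho> where "\<rho> D = (\<lambda>x. \<sigma> (inv (c D) \<otimes> x \<otimes> c D))" for D
  have conj_\<rho>: "conj_rep G (c D) (n, \<sigma>) = (n, \<rho> D)" for D by (simp add: conj_rep_def \<rho>_def)
  have \<rho>: "(n, \<rho> D) \<in> fd_irreps (subgroup_of G N) (subtopology T N)" if "D \<in> Orb" for D
    using conj_rep_fd_irreps[OF TG normal_N H_carrier[OF cH[OF that]] \<sigma>] by (simp only: conj_\<rho>)
  have class_\<rho>: "D = E `` {(n, \<rho> D)}" if "D \<in> Orb" for D using cD[OF that] by (simp only: conj_\<rho>)
  have \<rho>rep: "unitary_rep (subgroup_of G N) (subtopology T N) n (\<rho> D)" if "D \<in> Orb" for D
    using \<rho>[OF that] by (simp add: fd_irreps_def)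
  have \<rho>u: "unitary_mat n (\<rho> D z)" if "D \<in> Orb" "z \<in> N" for D z
    using unitary_rep_unitary[OF \<rho>rep[OF that(1)]] that(2) by simp
  have \<rho>mult: "\<rho> D y * \<rho> D z = \<rho> D (y \<otimes> z)" if "D \<in> Orb" "y \<in> N" "z \<in> N" for D y z
    using \<rho>rep[OF that(1)] that(2,3) by (simp add: unitary_rep_def)

  define F where "F z = (\<Sum>D\<in>Orb. rep_character n (\<rho> D) z)" for z
  have F_inv: "F (k \<otimes> z \<otimes> inv k) = F z" if k: "k \<in> H" and z: "z \<in> N" for k z
  proof -
    have ki: "inv k \<in> H" using subgroup.m_inv_closed[OF subgroup_H k] .
    have bij: "bij_betw (dual_action G T N (inv k)) Orb Orb"
      unfolding Orb_def by (rule dual_action_permutes_orbit[OF C ki])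
    have "rep_character n (\<rho> D) (k \<otimes> z \<otimes> inv k) = rep_character n (\<rho> (dual_action G T N (inv k) D)) z"
      if D: "D \<in> Orb" for D
    proof -
      define D' where "D' = dual_action G T N (inv k) D"
      have D': "D' \<in> Orb" unfolding D'_def using bij D by (auto simp: bij_betw_def)
      have conj: "conj_rep G (inv k) (n, \<rho> D) = (n, \<lambda>y. \<rho> D (k \<otimes> y \<otimes> inv k))"
        using H_carrier[OF k] by (simp add: conj_rep_def)
      have "D' = E `` {conj_rep G (inv k) (n, \<rho> D)}"
        unfolding D'_def
        by (subst class_\<rho>[OF D], rule dual_action_class[OF TG normal_N H_carrier[OF ki] \<rho>[OF D]])
      then have "E `` {(n, \<lambda>y. \<rho> D (k \<otimes> y \<otimes> inv k))} = E `` {(n, \<rho> D')}"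
        using class_\<rho>[OF D'] unfolding conj by simp
      then have "((n, \<lambda>y. \<rho> D (k \<otimes> y \<otimes> inv k)), (n, \<rho> D')) \<in> E"
        using eq_equiv_class[OF _ equiv_unitary_equivalence \<rho>[OF D']] by simp
      then have "rep_character n (\<rho> D') z = rep_character n (\<lambda>y. \<rho> D (k \<otimes> y \<otimes> inv k)) z"
        using z by (intro rep_character_equivalent) auto
      then show ?thesis by (simp add: D'_def rep_character_def)
    qed
    then have "F (k \<otimes> z \<otimes> inv k) = (\<Sum>D\<in>Orb. rep_character n (\<rho> (dual_action G T N (inv k) D)) z)"
      unfolding F_def by (intro sum.cong refl)
    also have "\<dots> = F z" unfolding F_def by (rule sum.reindex_bij_betw[OF bij])
    finally show ?thesis .
  qed

  \<comment> \<open>\<open>e\<close> numbers the entries of the matrices \<open>\<rho> D y\<close>; \<open>\<phi> y\<close> is the resulting vector.\<close>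
  define M where "M = card (Orb \<times> {..<n} \<times> {..<n})"
  obtain e where e: "bij_betw e {..<M} (Orb \<times> {..<n} \<times> {..<n})"
    using ex_bij_betw_nat_finite[of "Orb \<times> {..<n} \<times> {..<n}"] finO by (auto simp: M_def lessThan_atLeast0)
  define \<phi> where "\<phi> y i = (case e i of (D, a, b) \<Rightarrow> \<rho> D y $$ (a, b))" for y i
  have e_range: "D \<in> Orb \<and> a < n \<and> b < n" if "i < M" "e i = (D, a, b)" for i D a b
    using bij_betwE[OF e] that by (metis lessThan_iff mem_Sigma_iff)
  have gram0: "(\<Sum>i<M. cnj (\<phi> y i) * \<phi> z i) = F (inv y \<otimes> z)" if y: "y \<in> N" and z: "z \<in> N" for y z
  proof -
    have yz: "inv y \<otimes> z \<in> N" using y z by simp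
    have "(\<Sum>i<M. cnj (\<phi> y i) * \<phi> z i)
        = (\<Sum>i<M. (\<lambda>(D, a, b). cnj (\<rho> D y $$ (a, b)) * \<rho> D z $$ (a, b)) (e i))"
      by (intro sum.cong) (auto simp: \<phi>_def split: prod.splits)
    also have "\<dots> = (\<Sum>(D, a, b)\<in>Orb \<times> {..<n} \<times> {..<n}. cnj (\<rho> D y $$ (a, b)) * \<rho> D z $$ (a, b))"
      by (rule sum.reindex_bij_betw[OF e])
    also have "\<dots> = (\<Sum>D\<in>Orb. \<Sum>a<n. \<Sum>b<n. cnj (\<rho> D y $$ (a, b)) * \<rho> D z $$ (a, b))"
      by (simp only: sum.cartesian_product)
    also have "\<dots> = F (inv y \<otimes> z)"
      unfolding F_def
    proof (rule sum.cong[OF refl])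
      fix D assume D: "D \<in> Orb"
      have "y \<otimes> (inv y \<otimes> z) = z" using N_carrier[OF y] N_carrier[OF z] by (simp flip: m_assoc)
      then have "\<rho> D y * \<rho> D (inv y \<otimes> z) = \<rho> D z" using \<rho>mult[OF D y yz] by simp
      then show "(\<Sum>a<n. \<Sum>b<n. cnj (\<rho> D y $$ (a, b)) * \<rho> D z $$ (a, b)) = rep_character n (\<rho> D) (inv y \<otimes> z)"
        by (rule inner_eq_rep_character[where \<rho> = "\<rho> D" and x = y and y = z and z = "inv y \<otimes> z", OF \<rho>u[OF D y] _ unitary_mat_carrier[OF \<rho>u[OF D yz]]])
    qed
    finally show ?thesis .
  qed

  \<comment> \<open>The action of \<open>G\<close> on \<open>N = G/H\<close>: left translation by \<open>N\<close> and conjugation by \<open>H\<close>.\<close>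
  define act where "act g y = g \<otimes> y \<otimes> inv (H_part g)" for g y
  have act_N: "act g y \<in> N" if g: "g \<in> carrier G" and y: "y \<in> N" for g y
  proof -
    have "inv (H_part g) \<otimes> (H_part g \<otimes> y \<otimes> inv (H_part g)) = y \<otimes> inv (H_part g)"
      using H_part_carrier[OF g] N_carrier[OF y] by (simp flip: m_assoc)
    then have "act g y = g \<otimes> inv (H_part g) \<otimes> (H_part g \<otimes> y \<otimes> inv (H_part g))"
      unfolding act_def using g H_part_carrier[OF g] N_carrier[OF y] by (simp add: m_assoc)
    then show ?thesis using mult_inv_H_part_in_N[OF g] inv_op_closed2[OF H_part_carrier[OF g] y] by simp
  qed
  have act_mult: "act (g \<otimes> k) y = act g (act k y)" if "g \<in> carrier G" "k \<in> carrier G" "y \<in> N" for g k y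
    unfolding act_def using that H_part_carrier N_carrier by (simp add: H_part_mult inv_mult_group m_assoc)
  have gram: "(\<Sum>i<M. cnj (\<phi> y i) * \<phi> z i) = (\<Sum>i<M. cnj (\<phi> (act g y) i) * \<phi> (act g z) i)"
    if g: "g \<in> carrier G" and y: "y \<in> N" and z: "z \<in> N" for g y z
  proof -
    have "inv g \<otimes> (g \<otimes> w) = w" if "w \<in> carrier G" for w using g that by (simp flip: m_assoc)
    then have "inv (act g y) \<otimes> act g z = H_part g \<otimes> (inv y \<otimes> z) \<otimes> inv (H_part g)"
      unfolding act_def using g H_part_carrier[OF g] N_carrier[OF y] N_carrier[OF z] by (simp add: inv_mult_group m_assoc)
    then show ?thesis
      using gram0[OF y z] gram0[OF act_N[OF g y] act_N[OF g z]] F_inv[OF H_part_in_H[OF g], of "inv y \<otimes> z"] y z by simp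
  qed
  have cont: "continuous_map T euclidean (\<lambda>g. \<phi> (act g y) i)" if y: "y \<in> N" and i: "i < M" for y i
  proof -
    obtain D a b where ei: "e i = (D, a, b)" by (cases "e i")
    have "continuous_map T T (\<lambda>g. act g y)"
      unfolding act_def using N_carrier[OF y] topT continuous_map_into_fulltopology[OF continuous_map_H_part]
      by (intro continuous_map_mult continuous_map_inv) auto
    then have "continuous_map T (subtopology T N) (\<lambda>g. act g y)"
      using act_N y topT by (auto simp: continuous_map_in_subtopology)
    moreover have "continuous_map (subtopology T N) euclidean (\<lambda>z. \<rho> D z $$ (a, b))"
      using \<rho>rep e_range[OF i ei] by (simp add: unitary_rep_def)
    ultimately have "continuous_map T euclidean ((\<lambda>z. \<rho> D z $$ (a, b)) \<circ> (\<lambda>g. act g y))"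
      by (rule continuous_map_compose)
    then show ?thesis by (simp add: \<phi>_def ei o_def)
  qed
  obtain k \<pi> where \<pi>: "unitary_rep G T k \<pi>"
    and \<pi>sep: "\<forall>g\<in>carrier G. \<forall>g'\<in>carrier G. \<forall>y\<in>N. \<forall>i<M. \<phi> (act g y) i \<noteq> \<phi> (act g' y) i \<longrightarrow> \<pi> g \<noteq> \<pi> g'"
    and \<pi>fin: "finite ((\<lambda>y. restrict (\<phi> y) {..<M}) ` N) \<longrightarrow> finite (\<pi> ` carrier G)"
    using unitary_rep_on_span[where X = N and act = act and \<phi> = \<phi> and D = M,
          OF is_group topT act_N act_mult gram cont] by blast

  have "dual_action G T N \<one> C = C" by (rule dual_action_one[OF C])
  then have "C \<in> Orb" unfolding Orb_def dual_orbit_def using subgroup.one_closed[OF subgroup_H] by force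
  have "((n, \<rho> C), (n, \<sigma>)) \<in> E"
    using eq_equiv_class[OF _ equiv_unitary_equivalence \<sigma>] class_\<rho>[OF \<open>C \<in> Orb\<close>] by (simp add: C_def)
  then obtain U where "\<And>z. z \<in> N \<Longrightarrow> \<sigma> z = U * \<rho> C z * U\<^sup>H"
    by (rule unitary_equivalenceE) auto
  then have "\<rho> C x \<noteq> \<rho> C x'" using x by metis
  then obtain a b where ab: "a < n" "b < n" "\<rho> C x $$ (a, b) \<noteq> \<rho> C x' $$ (a, b)"
    using \<rho>u[OF \<open>C \<in> Orb\<close> x(1)] \<rho>u[OF \<open>C \<in> Orb\<close> x(2)]
    by (metis carrier_matD eq_matI unitary_mat_carrier)
  then have "(C, a, b) \<in> e ` {..<M}" using e \<open>C \<in> Orb\<close> by (simp add: bij_betw_def)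
  then obtain i where i: "i < M" "e i = (C, a, b)" by force
  \<comment> \<open>The base point \<open>\<one>\<close> is moved to \<open>x\<close> and \<open>x'\<close>, where \<open>\<phi>\<close> takes different values.\<close>
  have act_one: "act (y \<otimes> h) \<one> = y" if y: "y \<in> N" for y
    unfolding act_def using N_carrier[OF y] H_carrier[OF h] by (simp add: H_part_mult H_part_of_N H_part_of_H y h m_assoc)
  have "\<pi> (x \<otimes> h) \<noteq> \<pi> (x' \<otimes> h)"
    by (rule \<pi>sep[rule_format, of _ _ \<one> i])
       (use x h N_carrier H_carrier ab i in \<open>simp_all add: act_one \<phi>_def\<close>)
  moreover have "finite (\<pi> ` carrier G)" if "finite (\<sigma> ` N)"
  proof (rule \<pi>fin[rule_format])
    have "finite ((\<lambda>y. \<phi> y i) ` N)" if i: "i < M" for i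
    proof -
      obtain D a b where ei: "e i = (D, a, b)" by (cases "e i")
      have "c D \<in> carrier G" using e_range[OF i ei] cH H_carrier by blast
      then have "(\<lambda>y. \<phi> y i) ` N \<subseteq> (\<lambda>A. A $$ (a, b)) ` \<sigma> ` N"
        using inv_op_closed1 by (auto simp: \<phi>_def ei \<rho>_def)
      then show ?thesis using \<open>finite (\<sigma> ` N)\<close> finite_subset by blast
    qed
    then have "finite (Pi\<^sub>E {..<M} (\<lambda>i. (\<lambda>y. \<phi> y i) ` N))" by (intro finite_PiE) auto
    moreover have "(\<lambda>y. restrict (\<phi> y) {..<M}) ` N \<subseteq> Pi\<^sub>E {..<M} (\<lambda>i. (\<lambda>y. \<phi> y i) ` N)"
      by (intro image_subsetI PiE_I) (simp_all add: restrict_def)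
    ultimately show "finite ((\<lambda>y. restrict (\<phi> y) {..<M}) ` N)" using finite_subset by blast
  qed
  ultimately show thesis using that \<pi> fin by blast
qed

lemma fd_irreps_pullback:
  assumes \<sigma>: "(n, \<sigma>) \<in> fd_irreps (subgroup_of G H) (subtopology T H)"
  shows "(n, \<lambda>g. \<sigma> (H_part g)) \<in> fd_irreps G T"
proof -
  have rep: "unitary_rep (subgroup_of G H) (subtopology T H) n \<sigma>" and irr: "irreducible_rep (subgroup_of G H) n \<sigma>"
    using \<sigma> by (auto simp: fd_irreps_def)
  have "continuous_map T euclidean (\<lambda>g. \<sigma> (H_part g) $$ (i, j))" if "i < n" "j < n" for i j
  proof -
    have "continuous_map (subtopology T H) euclidean (\<lambda>g. \<sigma> g $$ (i, j))"
      using rep that by (simp add: unitary_rep_def)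
    from continuous_map_compose[OF continuous_map_H_part this] show ?thesis by (simp add: o_def)
  qed
  then have "unitary_rep G T n (\<lambda>g. \<sigma> (H_part g))"
    using rep H_part_in_H by (simp add: unitary_rep_def H_part_mult)
  moreover have "(\<forall>g\<in>carrier G. \<forall>w\<in>W. \<sigma> (H_part g) *\<^sub>v w \<in> W) \<longleftrightarrow> (\<forall>h\<in>H. \<forall>w\<in>W. \<sigma> h *\<^sub>v w \<in> W)" for W
    using H_part_in_H H_part_of_H H_carrier by metis
  then have "irreducible_rep G n (\<lambda>g. \<sigma> (H_part g))" using irr by (simp add: irreducible_rep_def)
  ultimately show ?thesis by (simp add: fd_irreps_def)
qed

text \<open>
If \<open>P\<close> embeds \<open>\<sigma>\<close> in \<open>\<pi>\<close> restricted to \<open>N\<close>, then \<open>\<pi>(h) P\<close> embeds \<open>\<sigma>\<^sup>h\<close>. So the orbit consists of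
constituents of a single representation of \<open>N\<close>.
\<close>

lemma finite_orbit_of_constituent:
  assumes \<pi>: "unitary_rep G T n \<pi>" and \<sigma>: "(k, \<sigma>) \<in> fd_irreps (subgroup_of G N) (subtopology T N)"
    and emb: "embeds_via (subgroup_of G N) k \<sigma> n \<pi> P"
  shows "finite (dual_orbit G T N H (E `` {(k, \<sigma>)}))"
proof -
  note P = embeds_viaD[OF emb]
  have "dual_action G T N h (E `` {(k, \<sigma>)}) \<in> {E `` {(l, \<tau>)} | l \<tau>.
      (l, \<tau>) \<in> fd_irreps (subgroup_of G N) (subtopology T N) \<and>
      (\<exists>Q. embeds_via (subgroup_of G N) l \<tau> n \<pi> Q)}" if h: "h \<in> H" for h
  proof -
    note hG = H_carrier[OF h]
    define \<tau> where "\<tau> = (\<lambda>x. \<sigma> (inv h \<otimes> x \<otimes> h))"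
    have conj: "conj_rep G h (k, \<sigma>) = (k, \<tau>)" by (simp add: conj_rep_def \<tau>_def)
    have \<tau>: "(k, \<tau>) \<in> fd_irreps (subgroup_of G N) (subtopology T N)"
      using conj_rep_fd_irreps[OF TG normal_N hG \<sigma>] by (simp only: conj)
    have "embeds_via (subgroup_of G N) k \<tau> n \<pi> (\<pi> h * P)"
      unfolding embeds_via_def
    proof (intro conjI ballI)
      show "isometry_mat n k (\<pi> h * P)"
        by (rule isometry_mat_mult[OF unitary_mat_isometry[OF unitary_rep_unitary[OF \<pi> hG]] P(1)])
      fix x assume x: "x \<in> carrier (subgroup_of G N)"
      then have xN: "x \<in> N" by simp
      note xG = N_carrier[OF xN] and \<pi>c = unitary_rep_carrier[OF \<pi>]
      define y where "y = inv h \<otimes> x \<otimes> h"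
      have yN: "y \<in> N" unfolding y_def by (rule inv_op_closed1[OF hG xN])
      then have y: "y \<in> carrier (subgroup_of G N)" by simp
      note yG = N_carrier[OF yN]
      show "\<tau> x \<in> carrier_mat k k" by (rule fd_irreps_carrier[OF \<tau> x])
      have "h \<otimes> (inv h \<otimes> w) = w" if "w \<in> carrier G" for w
        using hG that by (simp flip: m_assoc)
      then have "x \<otimes> h = h \<otimes> y" unfolding y_def using hG xG by (simp add: m_assoc)
      moreover have "\<pi> (g \<otimes> g') = \<pi> g * \<pi> g'" if "g \<in> carrier G" "g' \<in> carrier G" for g g'
        using \<pi> that by (simp add: unitary_rep_def)
      ultimately have "\<pi> x * \<pi> h = \<pi> h * \<pi> y" using hG xG yG by metis
      then have "\<pi> x * (\<pi> h * P) = \<pi> h * (\<pi> y * P)"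
        using assoc_mult_mat[OF \<pi>c[OF xG] \<pi>c[OF hG] P(2)] assoc_mult_mat[OF \<pi>c[OF hG] \<pi>c[OF yG] P(2)] by simp
      also have "\<dots> = \<pi> h * P * \<tau> x"
        using assoc_mult_mat[OF \<pi>c[OF hG] P(2) P(3)[OF y]] P(4)[OF y] by (simp add: \<tau>_def y_def)
      finally show "\<pi> x * (\<pi> h * P) = \<pi> h * P * \<tau> x" .
    qed
    then show ?thesis
      unfolding dual_action_class[OF TG normal_N hG \<sigma>] conj using \<tau> by blast
  qed
  then have "dual_orbit G T N H (E `` {(k, \<sigma>)}) \<subseteq> {E `` {(l, \<tau>)} | l \<tau>.
      (l, \<tau>) \<in> fd_irreps (subgroup_of G N) (subtopology T N) \<and>
      (\<exists>Q. embeds_via (subgroup_of G N) l \<tau> n \<pi> Q)}"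
    unfolding dual_orbit_def by blast
  moreover have "unitary_mat n (\<pi> x)" if "x \<in> carrier (subgroup_of G N)" for x
    using unitary_rep_unitary[OF \<pi>] N_carrier that by simp
  then have "finite {E `` {(l, \<tau>)} | l \<tau>.
      (l, \<tau>) \<in> fd_irreps (subgroup_of G N) (subtopology T N) \<and>
      (\<exists>Q. embeds_via (subgroup_of G N) l \<tau> n \<pi> Q)}" by (rule finite_constituents)
  ultimately show ?thesis by (rule finite_subset)
qed

lemma separates_points_restrict_H:
  assumes sep: "separates_points G (image_restricted_dual fin G T)"
  shows "separates_points (subgroup_of G H) (image_restricted_dual fin (subgroup_of G H) (subtopology T H))"
proof (rule separates_pointsI)
  fix g g' assume g: "g \<in> carrier (subgroup_of G H)" "g' \<in> carrier (subgroup_of G H)" "g \<noteq> g'"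
  have gG: "g \<in> carrier G" "g' \<in> carrier G" using g H_carrier by auto
  obtain n \<pi> where \<pi>: "(n, \<pi>) \<in> fd_irreps G T" "fin \<longrightarrow> finite (\<pi> ` carrier G)"
    "unitary_equivalence G T `` {(n, \<pi>)} \<in> image_restricted_dual fin G T" "\<pi> g \<noteq> \<pi> g'"
    by (rule separates_pointsE[OF sep subset_refl gG g(3)])
  have rep: "unitary_rep (subgroup_of G H) (subtopology T H) n \<pi>"
    using \<pi>(1) H_carrier by (intro unitary_rep_restrict) (auto simp: fd_irreps_def)
  have "\<pi> ` carrier (subgroup_of G H) \<subseteq> \<pi> ` carrier G" using H_carrier by auto
  then have "fin \<longrightarrow> finite (\<pi> ` carrier (subgroup_of G H))" using \<pi>(2) finite_subset by blast
  then obtain k \<sigma> P where "(k, \<sigma>) \<in> fd_irreps (subgroup_of G H) (subtopology T H)" "\<sigma> g \<noteq> \<sigma> g'"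
    "fin \<longrightarrow> finite (\<sigma> ` carrier (subgroup_of G H))"
    using exists_separating_irrep[OF group_H topH rep g(1,2) \<pi>(4)] by blast
  then show "\<exists>k \<sigma>. (k, \<sigma>) \<in> fd_irreps (subgroup_of G H) (subtopology T H) \<and>
      unitary_equivalence (subgroup_of G H) (subtopology T H) `` {(k, \<sigma>)}
        \<in> image_restricted_dual fin (subgroup_of G H) (subtopology T H) \<and> \<sigma> g \<noteq> \<sigma> g'"
    using class_mem_image_restricted_dual by blast
qed

lemma separates_points_restrict_N:
  assumes sep: "separates_points G (image_restricted_dual fin G T)"
  shows "separates_points (subgroup_of G N) (image_restricted_dual_per fin G T N H)"
proof (rule separates_pointsI[where T = "subtopology T N"])
  fix g g' assume g: "g \<in> carrier (subgroup_of G N)" "g' \<in> carrier (subgroup_of G N)" "g \<noteq> g'"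
  have gG: "g \<in> carrier G" "g' \<in> carrier G" using g N_carrier by auto
  obtain n \<pi> where \<pi>: "(n, \<pi>) \<in> fd_irreps G T" "fin \<longrightarrow> finite (\<pi> ` carrier G)"
    "unitary_equivalence G T `` {(n, \<pi>)} \<in> image_restricted_dual fin G T" "\<pi> g \<noteq> \<pi> g'"
    by (rule separates_pointsE[OF sep subset_refl gG g(3)])
  have \<pi>rep: "unitary_rep G T n \<pi>" using \<pi>(1) by (simp add: fd_irreps_def)
  have rep: "unitary_rep (subgroup_of G N) (subtopology T N) n \<pi>"
    using \<pi>rep N_carrier by (intro unitary_rep_restrict) auto
  have "\<pi> ` carrier (subgroup_of G N) \<subseteq> \<pi> ` carrier G" using N_carrier by auto
  then have "fin \<longrightarrow> finite (\<pi> ` carrier (subgroup_of G N))" using \<pi>(2) finite_subset by blast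
  then obtain k \<sigma> P where \<sigma>: "(k, \<sigma>) \<in> fd_irreps (subgroup_of G N) (subtopology T N)" "\<sigma> g \<noteq> \<sigma> g'"
    "embeds_via (subgroup_of G N) k \<sigma> n \<pi> P" "fin \<longrightarrow> finite (\<sigma> ` carrier (subgroup_of G N))"
    using exists_separating_irrep[OF group_N topN rep g(1,2) \<pi>(4)] by blast
  have "E `` {(k, \<sigma>)} \<in> image_restricted_dual_per fin G T N H"
    unfolding image_restricted_dual_per_def
    using class_mem_image_restricted_dual[OF \<sigma>(1,4)] finite_orbit_of_constituent[OF \<pi>rep \<sigma>(1,3)] by blast
  then show "\<exists>k \<sigma>. (k, \<sigma>) \<in> fd_irreps (subgroup_of G N) (subtopology T N) \<and>
      E `` {(k, \<sigma>)} \<in> image_restricted_dual_per fin G T N H \<and> \<sigma> g \<noteq> \<sigma> g'"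
    using \<sigma> by blast
qed

text \<open>
Elements of \<open>G\<close> with different \<open>H\<close>-parts are separated by a representation of \<open>H\<close>; elements \<open>x h\<close> and \<open>x' h\<close>
with the same \<open>H\<close>-part are separated by extending a periodic representation of \<open>N\<close>.
\<close>

lemma separates_points_extend:
  assumes sepH: "separates_points (subgroup_of G H) (image_restricted_dual fin (subgroup_of G H) (subtopology T H))"
    and sepN: "separates_points (subgroup_of G N) (image_restricted_dual_per fin G T N H)"
  shows "separates_points G (image_restricted_dual fin G T)"
proof (rule separates_pointsI)
  fix g g' assume g: "g \<in> carrier G" "g' \<in> carrier G" "g \<noteq> g'"
  have "\<exists>n \<pi>. (n, \<pi>) \<in> fd_irreps G T \<and> (fin \<longrightarrow> finite (\<pi> ` carrier G)) \<and> \<pi> g \<noteq> \<pi> g'"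
  proof (cases "H_part g = H_part g'")
    case False
    have "H_part g \<in> carrier (subgroup_of G H)" "H_part g' \<in> carrier (subgroup_of G H)" using H_part_in_H g by auto
    then obtain n \<sigma> where \<sigma>: "(n, \<sigma>) \<in> fd_irreps (subgroup_of G H) (subtopology T H)"
      "fin \<longrightarrow> finite (\<sigma> ` carrier (subgroup_of G H))" "\<sigma> (H_part g) \<noteq> \<sigma> (H_part g')"
      using separates_pointsE[OF sepH subset_refl _ _ False] by metis
    have "(\<lambda>g. \<sigma> (H_part g)) ` carrier G \<subseteq> \<sigma> ` carrier (subgroup_of G H)" using H_part_in_H by auto
    then have "fin \<longrightarrow> finite ((\<lambda>g. \<sigma> (H_part g)) ` carrier G)" using \<sigma>(2) finite_subset by blast
    then show ?thesis using fd_irreps_pullback[OF \<sigma>(1)] \<sigma>(3) by blast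
  next
    case True
    define x x' where "x = g \<otimes> inv (H_part g)" and "x' = g' \<otimes> inv (H_part g)"
    have x: "x \<in> N" "x' \<in> N" using mult_inv_H_part_in_N[OF g(1)] mult_inv_H_part_in_N[OF g(2)] True by (simp_all add: x_def x'_def)
    have gx: "g = x \<otimes> H_part g" "g' = x' \<otimes> H_part g"
      using g H_carrier[OF H_part_in_H[OF g(1)]] by (simp_all add: x_def x'_def m_assoc)
    then have "x \<noteq> x'" using g(3) by auto
    have xc: "x \<in> carrier (subgroup_of G N)" "x' \<in> carrier (subgroup_of G N)" using x by auto
    have sub: "image_restricted_dual_per fin G T N H \<subseteq> image_restricted_dual fin (subgroup_of G N) (subtopology T N)"
      by (auto simp: image_restricted_dual_per_def)
    obtain n \<sigma> where \<sigma>: "(n, \<sigma>) \<in> fd_irreps (subgroup_of G N) (subtopology T N)"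
      "fin \<longrightarrow> finite (\<sigma> ` carrier (subgroup_of G N))"
      "E `` {(n, \<sigma>)} \<in> image_restricted_dual_per fin G T N H" "\<sigma> x \<noteq> \<sigma> x'"
      using separates_pointsE[OF sepN sub xc \<open>x \<noteq> x'\<close>] .
    have per: "finite (dual_orbit G T N H (E `` {(n, \<sigma>)}))"
      using \<sigma>(3) by (simp add: image_restricted_dual_per_def)
    have fin': "fin \<longrightarrow> finite (\<sigma> ` N)" using \<sigma>(2) by simp
    obtain k \<pi> where \<pi>: "unitary_rep G T k \<pi>" "\<pi> (x \<otimes> H_part g) \<noteq> \<pi> (x' \<otimes> H_part g)" "fin \<longrightarrow> finite (\<pi> ` carrier G)"
      using unitary_rep_extending_periodic[OF \<sigma>(1) per fin' x \<sigma>(4) H_part_in_H[OF g(1)]] .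
    have "\<pi> g \<noteq> \<pi> g'" using \<pi>(2) gx by metis
    then show ?thesis
      using exists_separating_irrep[OF is_group topT \<pi>(1) g(1,2) _ \<pi>(3)] by metis
  qed
  then show "\<exists>n \<pi>. (n, \<pi>) \<in> fd_irreps G T \<and>
      unitary_equivalence G T `` {(n, \<pi>)} \<in> image_restricted_dual fin G T \<and> \<pi> g \<noteq> \<pi> g'"
    using class_mem_image_restricted_dual by blast
qed

end

theorem corollary5:
  fixes G :: "('a, 'b) monoid_scheme" and T :: "'a topology" and N H :: "'a set"
  assumes "locally_compact_group G T"
    and "topological_semidirect_product G T N H"
  shows "(maximally_almost_periodic G T \<longleftrightarrow>
            maximally_almost_periodic (subgroup_of G H) (subtopology T H) \<and>
            separates_points (subgroup_of G N) (fd_dual_per G T N H)) \<and>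
         (residually_finite G T \<longleftrightarrow>
            residually_finite (subgroup_of G H) (subtopology T H) \<and>
            separates_points (subgroup_of G N) (finite_dual_per G T N H))"
proof -
  interpret semidirect_top_group G T N H
    by (rule semidirect_top_group.intro) (use assms in \<open>simp_all add: locally_compact_group_def\<close>)
  have iff: "separates_points G (image_restricted_dual fin G T) \<longleftrightarrow>
      separates_points (subgroup_of G H) (image_restricted_dual fin (subgroup_of G H) (subtopology T H)) \<and>
      separates_points (subgroup_of G N) (image_restricted_dual_per fin G T N H)" for fin
    using separates_points_restrict_H separates_points_restrict_N separates_points_extend by blast
  show ?thesis
    using iff[of False] iff[of True]
    unfolding maximally_almost_periodic_def residually_finite_def image_restricted_dual_simps
      image_restricted_dual_per_simps by (rule conjI)
qed

end
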